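(* Let $\alpha=(\alpha_1,\ldots,\alpha_m)$ be a composition of $n$ (so $|\alpha|=n$ and $\ell(\alpha)=m$), let $g\ge 0$, and fix $\pi\in S_n$ of cycle type $\alpha$. Then $$(-1)^{|\alpha|+\ell(\alpha)}\, M^g_\alpha \;=\; \sum_{r\ge 0}(-1)^r I^g_\alpha(r) \;=\; \sum_{r\ge 0}(-1)^r P^g_\alpha(r) \;=\; C^g_\alpha(-1),$$ where $M^g_\alpha$ is the number of genus $g$ monotone factorizations of $\pi$, $I^g_\alpha(r)$ is the number of genus $g$ inequivalent factorizations of $\pi$ of length $r$, $P^g_\alpha(r)$ is the number of genus $g$ proper factorizations of $\pi$ of length $r$, and $C^g_\alpha(r)$ is the polynomial $C^g_\alpha(r)=\sum_{k}\binom{r}{k}P^g_\alpha(k)$ in $r$ (which for nonnegative integers $r$ equals the number of genus $g$ factorizations of $\pi$ of length $r$), evaluated at $r=-1$.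
   Context: Permutations are multiplied right to left. A factorization of $\pi\in S_n$ is a tuple $f=(\sigma_1,\ldots,\sigma_r)$ of elements of $S_n$ with $\sigma_1\cdots\sigma_r=\pi$; $r=\ell(f)$ is its length. Its signature is $\beta=(\beta_2,\beta_3,\ldots)$, where $\beta_j$ is the total number of disjoint cycles of length $j$ among all factors, and its depth is $d(f)=\sum_{j\ge2}(j-1)\beta_j$. The factorization is transitive if the group generated by its factors acts transitively on $\{1,\ldots,n\}$; for a transitive factorization of $\pi$, where $\pi$ has $\ell(\pi)$ cycles, its genus is the unique integer $g\ge0$ with $d(f)=n+\ell(\pi)-2+2g$. "Genus $g$ factorization" means transitive factorization of genus $g$. A factorization is proper if no factor is the identity. A cycle factorization is one in which every factor is a (nontrivial) cycle. Two cycle factorizations are equivalent if one can be obtained from the other by repeatedly interchanging adjacent disjoint (hence commuting) factors; an inequivalent factorization is an equivalence class of cycle factorizations under this relation (length, target permutation, signature, depth, transitivity and genus are class invariants). A monotone factorization is a factorization into transpositions $(a_1\,b_1)\cdot(a_2\,b_2)\cdots(a_r\,b_r)$ with $a_i<b_i$ for all $i$ and $b_1\le b_2\le\cdots\le b_r$. *)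

theory Defs
  imports
    Complex_Main
    "HOL-Library.Multiset"
    "HOL-Library.Groups_Big_Fun"
    "HOL-Combinatorics.Orbits"
    "HOL-Algebra.Sym_Groups"
    "HOL-Computational_Algebra.Polynomial"
begin

text \<open>
  An element of \<open>S\<^sub>n\<close> is a function \<open>p :: nat \<Rightarrow> nat\<close> with \<open>p permutes {1..n}\<close>, i.e. an element of
  the carrier of \<^const>\<open>sym_group\<close>; products are \<^const>\<open>comp\<close>, hence taken right to left.
\<close>

subsection \<open>Compositions and cycle type\<close>

definition composition :: "nat \<Rightarrow> nat list \<Rightarrow> bool" where
  "composition n \<alpha> \<longleftrightarrow> (\<forall>a\<in>set \<alpha>. 0 < a) \<and> sum_list \<alpha> = n"

text \<open>The disjoint cycles of \<open>p\<close>, fixed points included, represented by their underlying sets.\<close>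

definition perm_cycles :: "nat \<Rightarrow> (nat \<Rightarrow> nat) \<Rightarrow> nat set set" where
  "perm_cycles n p = orbit p ` {1..n}"

definition cycle_type_of :: "nat \<Rightarrow> (nat \<Rightarrow> nat) \<Rightarrow> nat multiset" where
  "cycle_type_of n p = image_mset card (mset_set (perm_cycles n p))"


subsection \<open>Factorizations\<close>

definition factorization :: "nat \<Rightarrow> (nat \<Rightarrow> nat) \<Rightarrow> (nat \<Rightarrow> nat) list \<Rightarrow> bool" where
  "factorization n \<pi> f \<longleftrightarrow> (\<forall>\<sigma>\<in>set f. \<sigma> permutes {1..n}) \<and> foldr (\<circ>) f id = \<pi>"

definition signature :: "nat \<Rightarrow> (nat \<Rightarrow> nat) list \<Rightarrow> nat \<Rightarrow> nat" where
  "signature n f j = (\<Sum>\<sigma>\<leftarrow>f. card {c \<in> perm_cycles n \<sigma>. card c = j})"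

text \<open>The sum stops at \<open>n\<close> because no cycle in \<open>S\<^sub>n\<close> is longer than \<open>n\<close>.\<close>

definition depth :: "nat \<Rightarrow> (nat \<Rightarrow> nat) list \<Rightarrow> nat" where
  "depth n f = (\<Sum>j = 2..n. (j - 1) * signature n f j)"

definition transitive_fact :: "nat \<Rightarrow> (nat \<Rightarrow> nat) list \<Rightarrow> bool" where
  "transitive_fact n f \<longleftrightarrow>
     (\<forall>x\<in>{1..n}. \<forall>y\<in>{1..n}. \<exists>h \<in> generate (sym_group n) (set f). h x = y)"

definition genus_factorization ::
  "nat \<Rightarrow> (nat \<Rightarrow> nat) \<Rightarrow> nat \<Rightarrow> (nat \<Rightarrow> nat) list \<Rightarrow> bool" where
  "genus_factorization n \<pi> g f \<longleftrightarrow>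
     factorization n \<pi> f \<and> transitive_fact n f \<and>
     int (depth n f) = int n + int (card (perm_cycles n \<pi>)) - 2 + 2 * int g"

definition proper :: "(nat \<Rightarrow> nat) list \<Rightarrow> bool" where
  "proper f \<longleftrightarrow> id \<notin> set f"

definition nontrivial_cycle :: "nat \<Rightarrow> (nat \<Rightarrow> nat) \<Rightarrow> bool" where
  "nontrivial_cycle n \<sigma> \<longleftrightarrow>
     (\<exists>cs. cycle cs \<and> 2 \<le> length cs \<and> set cs \<subseteq> {1..n} \<and> \<sigma> = cycle_of_list cs)"

definition cycle_factors :: "nat \<Rightarrow> (nat \<Rightarrow> nat) list \<Rightarrow> bool" where
  "cycle_factors n f \<longleftrightarrow> (\<forall>\<sigma>\<in>set f. nontrivial_cycle n \<sigma>)"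

definition disjoint_perms :: "('a \<Rightarrow> 'a) \<Rightarrow> ('a \<Rightarrow> 'a) \<Rightarrow> bool" where
  "disjoint_perms \<sigma> \<tau> \<longleftrightarrow> {x. \<sigma> x \<noteq> x} \<inter> {x. \<tau> x \<noteq> x} = {}"

inductive swap_step :: "('a \<Rightarrow> 'a) list \<Rightarrow> ('a \<Rightarrow> 'a) list \<Rightarrow> bool" where
  "disjoint_perms \<sigma> \<tau> \<Longrightarrow> swap_step (xs @ [\<sigma>, \<tau>] @ ys) (xs @ [\<tau>, \<sigma>] @ ys)"

text \<open>
  The reflexive transitive closure is already an equivalence, as \<^const>\<open>swap_step\<close> is symmetric.
  It lives on all lists; since swaps only permute the factors and preserve the product, the class
  of a cycle factorization of \<open>\<pi>\<close> consists of cycle factorizations of \<open>\<pi>\<close>.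
\<close>

definition swap_equiv :: "(('a \<Rightarrow> 'a) list \<times> ('a \<Rightarrow> 'a) list) set" where
  "swap_equiv = {(f, f'). swap_step\<^sup>*\<^sup>* f f'}"

definition monotone_factors :: "nat \<Rightarrow> (nat \<Rightarrow> nat) list \<Rightarrow> bool" where
  "monotone_factors n f \<longleftrightarrow>
     (\<exists>ts. f = map (\<lambda>(a, b). transpose a b) ts \<and>
           (\<forall>(a, b)\<in>set ts. 1 \<le> a \<and> a < b \<and> b \<le> n) \<and>
           sorted (map snd ts))"


subsection \<open>The numbers of factorizations\<close>

definition num_monotone :: "nat \<Rightarrow> (nat \<Rightarrow> nat) \<Rightarrow> nat \<Rightarrow> nat" where
  "num_monotone n \<pi> g = card {f. genus_factorization n \<pi> g f \<and> monotone_factors n f}"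

definition num_inequivalent :: "nat \<Rightarrow> (nat \<Rightarrow> nat) \<Rightarrow> nat \<Rightarrow> nat \<Rightarrow> nat" where
  "num_inequivalent n \<pi> g r =
     card ({f. genus_factorization n \<pi> g f \<and> cycle_factors n f \<and> length f = r} // swap_equiv)"

definition num_proper :: "nat \<Rightarrow> (nat \<Rightarrow> nat) \<Rightarrow> nat \<Rightarrow> nat \<Rightarrow> nat" where
  "num_proper n \<pi> g r = card {f. genus_factorization n \<pi> g f \<and> proper f \<and> length f = r}"

definition num_fact :: "nat \<Rightarrow> (nat \<Rightarrow> nat) \<Rightarrow> nat \<Rightarrow> nat \<Rightarrow> nat" where
  "num_fact n \<pi> g r = card {f. genus_factorization n \<pi> g f \<and> length f = r}"


subsection \<open>The polynomial of factorizations\<close>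

definition binom_poly :: "nat \<Rightarrow> rat poly" where
  "binom_poly k = smult (1 / fact k) (\<Prod>i<k. [:- of_nat i, 1:])"

lemma poly_binom_poly: "poly (binom_poly k) x = x gchoose k"
  by (simp add: binom_poly_def poly_prod gbinomial_prod_rev lessThan_atLeast0)

text \<open>
  \<^const>\<open>Sum_any\<close> is the sum over the support; it is 0 by convention if the support is infinite.
\<close>

definition fact_poly :: "nat \<Rightarrow> (nat \<Rightarrow> nat) \<Rightarrow> nat \<Rightarrow> rat poly" where
  "fact_poly n \<pi> g = Sum_any (\<lambda>k. smult (of_nat (num_proper n \<pi> g k)) (binom_poly k))"

end

(*
  Record for a word in S_n its product, its family of invariant sets and its depth. These statistics
  form a monoid graded by depth: transitivity means that only {} and {1..n} are invariant, and the
  depth and the invariant sets are compatible with the splitting of a permutation both into disjoint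
  cycles and into transpositions with decreasing larger entries. In the monoid ring, the element
  F = (sum of all permutations) has degree 0 part 1, hence exactly one inverse. Three signed sums
  are inverse to F, each by an involution:
  the proper words, by expanding 1 / (1 + (F - 1));
  the monotone words, as F is the sum of the strictly decreasing transposition words;
  the cycle words modulo commutation, as F is the sum over sets of disjoint cycles (Cartier-Foata).
  Comparing coefficients of the transitive statistics of given product and genus gives the theorem.
*)

theory Submission
  imports Defs
begin

subsection \<open>Invariant sets and depth\<close>

text \<open>The product alone would not do: in the group algebra of S_n, for n \<ge> 2, the sum of
  all permutations is a zero divisor and the signed sums over words are infinite. The depth repairs
  both. It adds up under concatenation and vanishes only at the identity among permutations, so only
  finitely many words of each family occur up to a given depth, and the coefficients of an inverse
  are determined recursively. Recording all invariant sets instead of the generated group makes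
  transitivity multiplicative, because concatenation intersects the families. It also gives access
  to the depth: a permutation with c cycles has 2^c invariant sets and depth n - c, so the effect of
  merging two cycles is found by counting sets. The delicate point is that F is a sum of single
  letters, while the involutions need each permutation spelled as a word with the same statistic.
  For arbitrary transposition words this fails, since a transposition can also split a cycle. It
  holds when each transposition attaches a point that the letters to its right fix. The monoid ring
  is never built; an identity in it is stated coefficient by coefficient, for each statistic
  s.\<close>

definition invariant_sets :: "nat \<Rightarrow> (nat \<Rightarrow> nat) list \<Rightarrow> nat set set" where
  "invariant_sets n f = {X. X \<subseteq> {1..n} \<and> (\<forall>\<sigma>\<in>set f. \<forall>x. \<sigma> x \<in> X \<longleftrightarrow> x \<in> X)}"

lemma finite_invariant_sets: "finite (invariant_sets n f)"
  by (rule finite_subset[of _ "Pow {1..n}"]) (auto simp: invariant_sets_def)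

lemma invariant_sets_append:
  "invariant_sets n (f @ g) = invariant_sets n f \<inter> invariant_sets n g"
  by (auto simp: invariant_sets_def)

lemma signature_append: "signature n (f @ g) j = signature n f j + signature n g j"
  by (simp add: signature_def)

lemma depth_append: "depth n (f @ g) = depth n f + depth n g"
  by (simp add: depth_def signature_append distrib_left sum.distrib)

lemma depth_Nil [simp]: "depth n [] = 0"
  by (simp add: depth_def signature_def)

lemma depth_Cons: "depth n (\<sigma> # f) = depth n [\<sigma>] + depth n f"
  using depth_append[of n "[\<sigma>]" f] by simp

lemma permutes_imp_permutation: "\<sigma> permutes {1..n::nat} \<Longrightarrow> permutation \<sigma>"
  by (auto simp: permutation_permutes)

lemma partition_on_perm_cycles:
  assumes "\<sigma> permutes {1..n}"
  shows "partition_on {1..n} (perm_cycles n \<sigma>)"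
proof -
  have self: "x \<in> orbit \<sigma> x" for x
    by (rule permutation_self_in_orbit[OF permutes_imp_permutation[OF assms]])
  show ?thesis
  proof (rule partition_onI)
    show "\<Union> (perm_cycles n \<sigma>) = {1..n}"
      using permutes_orbit_subset[OF assms] self by (fastforce simp: perm_cycles_def)
  next
    fix c d assume "c \<in> perm_cycles n \<sigma>" "d \<in> perm_cycles n \<sigma>" "c \<noteq> d"
    then obtain x y where xy: "c = orbit \<sigma> x" "d = orbit \<sigma> y"
      by (auto simp: perm_cycles_def)
    have "c = d" if z: "z \<in> c" "z \<in> d" for z
    proof -
      have "cyclic_on \<sigma> c" "cyclic_on \<sigma> d"
        using xy cyclic_on_orbit[OF assms finite_atLeastAtMost] by simp_all
      then show ?thesis using z by (metis cyclic_on_alldef)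
    qed
    with \<open>c \<noteq> d\<close> show "disjnt c d" by (auto simp: disjnt_def)
  next
    show "{} \<notin> perm_cycles n \<sigma>" using self by (auto simp: perm_cycles_def)
  qed
qed

text \<open>The cycles partition {1..n}, and each contributes its size minus one to the depth. Fixed
  points lie outside the range 2..n of the defining sum, but their contribution would be 0
  anyway.\<close>

lemma depth_plus_card_perm_cycles:
  assumes "\<sigma> permutes {1..n}"
  shows "depth n [\<sigma>] + card (perm_cycles n \<sigma>) = n"
proof -
  let ?P = "perm_cycles n \<sigma>"
  note part = partition_on_perm_cycles[OF assms]
  have finP: "finite ?P" by (simp add: perm_cycles_def)
  have sub: "c \<subseteq> {1..n}" if "c \<in> ?P" for c
    using partition_onD1[OF part] that by blast
  have fin: "finite c" if "c \<in> ?P" for c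
    using sub[OF that] finite_subset by blast
  have pos: "card c \<ge> 1" "card c \<le> n" if "c \<in> ?P" for c
  proof -
    have "c \<noteq> {}" using that partition_onD3[OF part] by auto
    then have "card c > 0" using fin[OF that] by (simp add: card_gt_0_iff)
    then show "card c \<ge> 1" by simp
    show "card c \<le> n" using card_mono[OF _ sub[OF that]] by simp
  qed
  have "depth n [\<sigma>] = (\<Sum>j = 2..n. \<Sum>c\<in>?P. if card c = j then j - 1 else 0)"
    using finP by (simp add: depth_def signature_def sum.If_cases Int_def mult.commute)
  also have "\<dots> = (\<Sum>c\<in>?P. \<Sum>j = 2..n. if card c = j then j - 1 else 0)"
    by (rule sum.swap)
  also have "\<dots> = (\<Sum>c\<in>?P. card c - 1)"
  proof (rule sum.cong[OF refl])
    fix c assume "c \<in> ?P"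
    with pos[OF this] show "(\<Sum>j = 2..n. if card c = j then j - 1 else 0) = card c - 1"
      by (cases "card c = 1") (auto simp: sum.delta)
  qed
  finally have "depth n [\<sigma>] + card ?P = (\<Sum>c\<in>?P. card c - 1 + 1)"
    by (simp only: sum.distrib sum_constant) simp
  also have "\<dots> = (\<Sum>c\<in>?P. card c)"
    by (rule sum.cong[OF refl]) (simp only: pos(1) le_add_diff_inverse2)
  also have "\<dots> = card (\<Union>?P)"
    using partition_onD2[OF part] fin
    by (intro card_Union_disjoint[symmetric]) (auto simp: pairwise_def disjoint_def disjnt_def)
  also have "\<dots> = n" using partition_onD1[OF part] by (simp flip: partition_onD1[OF part])
  finally show ?thesis .
qed

text \<open>An invariant set is a union of cycles, in exactly one way.\<close>

lemma card_invariant_sets: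
  assumes "\<sigma> permutes {1..n}"
  shows "card (invariant_sets n [\<sigma>]) = 2 ^ card (perm_cycles n \<sigma>)"
proof -
  let ?P = "perm_cycles n \<sigma>"
  note part = partition_on_perm_cycles[OF assms]
  have finP: "finite ?P" by (simp add: perm_cycles_def)
  have cyc: "\<sigma> x \<in> c \<longleftrightarrow> x \<in> c" if c: "c \<in> ?P" for c x
  proof -
    have "cyclic_on \<sigma> c"
      using c cyclic_on_orbit[OF assms finite_atLeastAtMost]
      by (auto simp: perm_cycles_def)
    then show ?thesis
      using cyclic_on_f_in[OF assms] cyclic_on_inI by fast
  qed
  have "bij_betw Union (Pow ?P) (invariant_sets n [\<sigma>])"
  proof (rule bij_betwI')
    fix A B assume AB: "A \<in> Pow ?P" "B \<in> Pow ?P"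
    have aux: "C \<subseteq> D" if CD: "C \<subseteq> ?P" "D \<subseteq> ?P" "\<Union>C \<subseteq> \<Union>D" for C D
    proof
      fix c assume c: "c \<in> C"
      then have "c \<noteq> {}" using partition_onD3[OF part] CD(1) by blast
      then obtain x where x: "x \<in> c" by blast
      then obtain d where d: "d \<in> D" "x \<in> d" using c CD(3) by blast
      have "c = d"
        using disjointD[OF partition_onD2[OF part], of c d] c d x CD by blast
      with d show "c \<in> D" by simp
    qed
    show "\<Union>A = \<Union>B \<longleftrightarrow> A = B"
      using aux[of A B] aux[of B A] AB by auto
  next
    fix A assume "A \<in> Pow ?P"
    then show "\<Union>A \<in> invariant_sets n [\<sigma>]"
      using cyc partition_onD1[OF part] by (auto simp: invariant_sets_def)
  next
    fix X assume X: "X \<in> invariant_sets n [\<sigma>]"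
    have orb: "orbit \<sigma> x \<subseteq> X" if "x \<in> X" for x
    proof
      fix y assume "y \<in> orbit \<sigma> x"
      then show "y \<in> X" by induction (use X that in \<open>auto simp: invariant_sets_def\<close>)
    qed
    moreover have "x \<in> orbit \<sigma> x" for x
      by (rule permutation_self_in_orbit[OF permutes_imp_permutation[OF assms]])
    ultimately have "X = \<Union>(orbit \<sigma> ` X)" by blast
    moreover have "orbit \<sigma> ` X \<in> Pow ?P"
      using X by (auto simp: invariant_sets_def perm_cycles_def)
    ultimately show "\<exists>A\<in>Pow ?P. X = \<Union>A" by blast
  qed
  then show ?thesis
    using bij_betw_same_card card_Pow[OF finP] by metis
qed

text \<open>Expresses the depth through invariant sets, free of cycles and of subtraction; the facts
  on the depth of a permutation that follow are derived from this form.\<close>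

lemma card_invariant_sets_depth:
  assumes "\<sigma> permutes {1..n}"
  shows "card (invariant_sets n [\<sigma>]) * 2 ^ depth n [\<sigma>] = 2 ^ n"
  by (metis assms card_invariant_sets depth_plus_card_perm_cycles add.commute power_add)

lemma depth_id: "depth n [id] = 0"
proof -
  have "invariant_sets n [id] = Pow {1..n}" by (auto simp: invariant_sets_def)
  then show ?thesis
    using card_invariant_sets_depth[of id n] by (simp add: card_Pow permutes_id)
qed

text \<open>Depth 0 would make every subset invariant, in particular the singleton of a moved
  point.\<close>

lemma depth_pos:
  assumes "\<sigma> permutes {1..n}" "\<sigma> \<noteq> id"
  shows "depth n [\<sigma>] > 0"
proof (rule ccontr)
  assume "\<not> ?thesis"
  then have c: "card (invariant_sets n [\<sigma>]) = 2 ^ n"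
    using card_invariant_sets_depth[OF assms(1)] by simp
  have "invariant_sets n [\<sigma>] = Pow {1..n}"
    by (rule card_subset_eq) (use c in \<open>auto simp: invariant_sets_def card_Pow\<close>)
  moreover obtain x where x: "\<sigma> x \<noteq> x" using assms(2) by (auto simp: fun_eq_iff)
  moreover have "x \<in> {1..n}" using x assms(1) by (metis permutes_not_in)
  ultimately have "{x} \<in> invariant_sets n [\<sigma>]" by simp
  then show False using x by (auto simp: invariant_sets_def)
qed

text \<open>Gluing the fixed point \<open>b\<close> to the cycle of \<open>a\<close> halves the number of invariant sets.\<close>

lemma transpose_comp_fixing:
  assumes "\<sigma> permutes {1..n}" "\<sigma> b = b" "a \<noteq> b" "a \<in> {1..n}" "b \<in> {1..n}"
  shows "invariant_sets n [transpose a b \<circ> \<sigma>] = invariant_sets n [transpose a b, \<sigma>]"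
    and "depth n [transpose a b \<circ> \<sigma>] = Suc (depth n [\<sigma>])"
proof -
  let ?t = "transpose a b"
  have perm: "?t \<circ> \<sigma> permutes {1..n}"
    using assms by (intro permutes_compose permutes_swap_id)
  have t: "(?t y \<in> X \<longleftrightarrow> y \<in> X)" if "a \<in> X \<longleftrightarrow> b \<in> X" for X y
    using that by (auto simp: transpose_def)
  have char: "X \<in> invariant_sets n [?t, \<sigma>] \<longleftrightarrow> X \<in> invariant_sets n [\<sigma>] \<and> (a \<in> X \<longleftrightarrow> b \<in> X)" for X
    using t by (auto simp: invariant_sets_def)
  show eq: "invariant_sets n [?t \<circ> \<sigma>] = invariant_sets n [?t, \<sigma>]"
  proof (intro equalityI subsetI)
    fix X assume "X \<in> invariant_sets n [?t, \<sigma>]"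
    then show "X \<in> invariant_sets n [?t \<circ> \<sigma>]" by (auto simp: invariant_sets_def)
  next
    \<comment> \<open>Since \<sigma> fixes b, the product sends b to a. Hence X cannot separate a
      from b, so the transposition preserves X and can be cancelled.\<close>
    fix X assume X: "X \<in> invariant_sets n [?t \<circ> \<sigma>]"
    then have "?t (\<sigma> b) \<in> X \<longleftrightarrow> b \<in> X" by (simp add: invariant_sets_def)
    then have ab: "a \<in> X \<longleftrightarrow> b \<in> X" using assms(2) by simp
    have "?t (\<sigma> x) \<in> X \<longleftrightarrow> x \<in> X" for x using X by (simp add: invariant_sets_def)
    then have "\<sigma> x \<in> X \<longleftrightarrow> x \<in> X" for x using t[OF ab] by simp
    then show "X \<in> invariant_sets n [?t, \<sigma>]"
      using X t[OF ab] by (auto simp: invariant_sets_def)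
  qed
  \<comment> \<open>Because b is a fixed point of \<sigma>, adding or removing it keeps a set
    invariant under \<sigma>. This toggle \<open>T\<close> pairs the invariant sets that separate a
    from b (\<open>Y\<close>) with those that do not, so the latter are exactly half of all.\<close>
  define Y where "Y = {X \<in> invariant_sets n [\<sigma>]. \<not> (a \<in> X \<longleftrightarrow> b \<in> X)}"
  define T where "T X = (if b \<in> X then X - {b} else insert b X)" for X :: "nat set"
  have inj: "\<sigma> x = b \<longleftrightarrow> x = b" for x
    using assms(1,2) by (metis permutes_inj injD)
  have TT: "T (T X) = X" for X by (auto simp: T_def)
  have Tinv: "T X \<in> invariant_sets n [\<sigma>]" if "X \<in> invariant_sets n [\<sigma>]" for X
    using that inj assms(5) by (auto simp: invariant_sets_def T_def)
  have Tab: "(a \<in> T X \<longleftrightarrow> b \<in> T X) \<longleftrightarrow> \<not> (a \<in> X \<longleftrightarrow> b \<in> X)" for X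
    using assms(3) by (auto simp: T_def)
  have "bij_betw T (invariant_sets n [?t, \<sigma>]) Y"
  proof (rule bij_betw_byWitness[where f' = T])
    show "T ` invariant_sets n [?t, \<sigma>] \<subseteq> Y"
      using Tinv Tab char unfolding Y_def by blast
    show "T ` Y \<subseteq> invariant_sets n [?t, \<sigma>]"
      using Tinv Tab char unfolding Y_def by blast
  qed (simp_all add: TT)
  then have cY: "card Y = card (invariant_sets n [?t, \<sigma>])"
    using bij_betw_same_card by metis
  have "invariant_sets n [\<sigma>] = invariant_sets n [?t, \<sigma>] \<union> Y"
    "invariant_sets n [?t, \<sigma>] \<inter> Y = {}"
    using char by (auto simp: Y_def)
  then have "card (invariant_sets n [\<sigma>]) = card (invariant_sets n [?t, \<sigma>]) + card Y"
    using finite_invariant_sets[of n "[\<sigma>]"] by (metis card_Un_disjoint finite_Un)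
  then have "card (invariant_sets n [\<sigma>]) = 2 * card (invariant_sets n [?t \<circ> \<sigma>])"
    using cY eq by simp
  moreover have "card (invariant_sets n [?t \<circ> \<sigma>]) * 2 ^ depth n [?t \<circ> \<sigma>] =
      card (invariant_sets n [\<sigma>]) * 2 ^ depth n [\<sigma>]"
    using card_invariant_sets_depth[OF perm] card_invariant_sets_depth[OF assms(1)] by simp
  moreover have "card (invariant_sets n [?t \<circ> \<sigma>]) > 0"
    using card_invariant_sets_depth[OF perm] by (metis mult_eq_0_iff neq0_conv power_not_zero zero_neq_numeral)
  ultimately have "(2::nat) ^ depth n [?t \<circ> \<sigma>] = 2 ^ Suc (depth n [\<sigma>])" by simp
  then show "depth n [?t \<circ> \<sigma>] = Suc (depth n [\<sigma>])" 
    using power_inject_exp[of "2::nat"] by (metis one_less_numeral_iff semiring_norm(76))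
qed

subsection \<open>Inverse families of words\<close>

definition word_prod :: "('a \<Rightarrow> 'a) list \<Rightarrow> 'a \<Rightarrow> 'a" where
  "word_prod f = foldr (\<circ>) f id"

lemma word_prod_simps [simp]:
  "word_prod [] = id" "word_prod (\<sigma> # f) = \<sigma> \<circ> word_prod f"
  by (simp_all add: word_prod_def)

definition factor_stat :: "nat \<Rightarrow> (nat \<Rightarrow> nat) list \<Rightarrow> (nat \<Rightarrow> nat) \<times> nat set set \<times> nat" where
  "factor_stat n f = (word_prod f, invariant_sets n f, depth n f)"

text \<open>
  The statistic takes values in a monoid graded by depth; in its monoid ring, a family of signed
  words is required to be a right inverse of the sum of all elements of \<open>S\<^sub>n\<close>.
\<close>

definition inverse_family ::
  "nat \<Rightarrow> 'k set \<Rightarrow> ('k \<Rightarrow> (nat \<Rightarrow> nat) list) \<Rightarrow> ('k \<Rightarrow> rat) \<Rightarrow> bool" where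
  "inverse_family n K wd sg \<longleftrightarrow>
     (\<forall>d. finite {k\<in>K. depth n (wd k) \<le> d}) \<and>
     (\<forall>s. (\<Sum>\<sigma> | \<sigma> permutes {1..n}. \<Sum>k | k \<in> K \<and> factor_stat n (\<sigma> # wd k) = s. sg k)
        = (if s = factor_stat n [] then 1 else 0))"

lemma word_prod_append: "word_prod (f @ g) = word_prod f \<circ> word_prod g"
  by (induction f) (auto simp: comp_assoc)

text \<open>Products compose, families of invariant sets intersect and depths add: this congruence
  is what makes the statistics a monoid.\<close>

lemma factor_stat_append_cong:
  assumes "factor_stat n f = factor_stat n f'" "factor_stat n g = factor_stat n g'"
  shows "factor_stat n (f @ g) = factor_stat n (f' @ g')"
  using assms
  by (simp add: factor_stat_def word_prod_append invariant_sets_append depth_append)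

lemma factor_stat_Cons_cong:
  "factor_stat n f = factor_stat n g \<Longrightarrow> factor_stat n (\<sigma> # f) = factor_stat n (\<sigma> # g)"
  using factor_stat_append_cong[of n "[\<sigma>]" "[\<sigma>]" f g] by simp

lemma factor_stat_id_Cons: "factor_stat n (id # f) = factor_stat n f"
  using depth_Cons[of n id f] by (simp add: factor_stat_def invariant_sets_def depth_id)

text \<open>The step by which permutations are spelled as words. A point b fixed by \<sigma>
  guarantees that the transposition merges two cycles; if a and b lay on one cycle, it would split
  that cycle and the depth would drop.\<close>

lemma transpose_stat:
  assumes "\<sigma> permutes {1..n}" "\<sigma> b = b" "a \<noteq> b" "a \<in> {1..n}" "b \<in> {1..n}"
  shows "factor_stat n [transpose a b \<circ> \<sigma>] = factor_stat n [transpose a b, \<sigma>]"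
proof -
  have "depth n [transpose a b] = 1"
    using transpose_comp_fixing(2)[OF permutes_id, where a = a and b = b] assms depth_id by simp
  then show ?thesis
    using transpose_comp_fixing[OF assms] depth_append[of n "[transpose a b]" "[\<sigma>]"]
    by (simp add: factor_stat_def comp_assoc)
qed

text \<open>Coefficient extraction in a product with the single letter \<sigma>. Intersection is not
  cancellative, so several statistics t may give s after prefixing \<sigma>. \<open>T\<close> is any
  finite set of such t that covers those attained; leaving it free allows two families to be
  compared over the same index set.\<close>

lemma sum_grouped_by_stat:
  assumes "finite {k\<in>K. depth n (wd k) \<le> snd (snd s)}"
    and "finite T"
    and "factor_stat n ` wd ` {k\<in>K. factor_stat n (\<sigma> # wd k) = s} \<subseteq> T"
    and "T \<subseteq> {factor_stat n w |w. factor_stat n (\<sigma> # w) = s}"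
  shows "(\<Sum>k | k \<in> K \<and> factor_stat n (\<sigma> # wd k) = s. sg k :: rat) =
    (\<Sum>t\<in>T. \<Sum>k | k \<in> K \<and> factor_stat n (wd k) = t. sg k)"
proof -
  let ?S = "{k\<in>K. factor_stat n (\<sigma> # wd k) = s}"
  have "depth n w \<le> snd (snd s)" if "factor_stat n (\<sigma> # w) = s" for w
    using that depth_Cons[of n \<sigma> w] by (auto simp: factor_stat_def)
  then have "?S \<subseteq> {k\<in>K. depth n (wd k) \<le> snd (snd s)}" by blast
  then have "finite ?S" using assms(1) finite_subset by blast
  then have "sum sg ?S = (\<Sum>t\<in>T. \<Sum>k | k \<in> ?S \<and> factor_stat n (wd k) = t. sg k)"
    using sum.group[of ?S T "factor_stat n \<circ> wd" sg] assms(2,3) by (simp add: image_comp)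
  also have "\<dots> = (\<Sum>t\<in>T. \<Sum>k | k \<in> K \<and> factor_stat n (wd k) = t. sg k)"
  proof (rule sum.cong[OF refl], rule sum.cong[OF _ refl])
    fix t assume "t \<in> T"
    then obtain w where w: "t = factor_stat n w" "factor_stat n (\<sigma> # w) = s" using assms(4) by blast
    then have "factor_stat n (\<sigma> # wd k) = s" if "factor_stat n (wd k) = t" for k
      using factor_stat_Cons_cong that by metis
    then show "{k \<in> ?S. factor_stat n (wd k) = t} = {k \<in> K. factor_stat n (wd k) = t}" by blast
  qed
  finally show ?thesis by simp
qed

text \<open>Compare the coefficients of s in both products. The letter \<open>id\<close> does not
  change the statistic, so it contributes the coefficient of s itself. Every other \<sigma> has
  positive depth and contributes only coefficients of smaller depth, which agree by
  induction.\<close>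

theorem inverse_family_unique:
  assumes "inverse_family n K wd sg" "inverse_family n K' wd' sg'"
  shows "(\<Sum>k | k \<in> K \<and> factor_stat n (wd k) = s. sg k) =
    (\<Sum>k | k \<in> K' \<and> factor_stat n (wd' k) = s. sg' k)"
proof (induction "snd (snd s)" arbitrary: s rule: less_induct)
  case less
  let ?f = "\<lambda>\<sigma>. \<Sum>k | k \<in> K \<and> factor_stat n (\<sigma> # wd k) = s. sg k"
  let ?f' = "\<lambda>\<sigma>. \<Sum>k | k \<in> K' \<and> factor_stat n (\<sigma> # wd' k) = s. sg' k"
  let ?S = "{\<sigma>. \<sigma> permutes {1..n}}"
  have finK: "finite {k\<in>K. depth n (wd k) \<le> d}" "finite {k\<in>K'. depth n (wd' k) \<le> d}" for d
    using assms by (auto simp: inverse_family_def)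
  have fins: "finite {k\<in>K. factor_stat n (\<sigma> # wd k) = s}"
    "finite {k\<in>K'. factor_stat n (\<sigma> # wd' k) = s}" for \<sigma>
  proof -
    have "depth n w \<le> snd (snd s)" if "factor_stat n (\<sigma> # w) = s" for w
      using that depth_Cons[of n \<sigma> w] by (auto simp: factor_stat_def)
    then show "finite {k\<in>K. factor_stat n (\<sigma> # wd k) = s}"
      "finite {k\<in>K'. factor_stat n (\<sigma> # wd' k) = s}"
      by (intro finite_subset[OF _ finK(1)[of "snd (snd s)"]] finite_subset[OF _ finK(2)[of "snd (snd s)"]]; blast)+
  qed
  have step: "?f \<sigma> = ?f' \<sigma>" if "\<sigma> \<in> ?S - {id}" for \<sigma>
  proof -
    \<comment> \<open>All statistics that give s after prefixing \<sigma> and occur in either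
      family, so that both sums are grouped over one index set.\<close>
    define T where "T = factor_stat n ` wd ` {k\<in>K. factor_stat n (\<sigma> # wd k) = s}
      \<union> factor_stat n ` wd' ` {k\<in>K'. factor_stat n (\<sigma> # wd' k) = s}"
    have T: "finite T" "T \<subseteq> {factor_stat n w |w. factor_stat n (\<sigma> # w) = s}"
      using fins by (auto simp: T_def)
    have "?f \<sigma> = (\<Sum>t\<in>T. \<Sum>k | k \<in> K \<and> factor_stat n (wd k) = t. sg k)"
      by (rule sum_grouped_by_stat[OF finK(1) T(1) _ T(2)]) (auto simp: T_def)
    also have "\<dots> = (\<Sum>t\<in>T. \<Sum>k | k \<in> K' \<and> factor_stat n (wd' k) = t. sg' k)"
    proof (rule sum.cong[OF refl])
      fix t assume "t \<in> T"
      then obtain w where w: "t = factor_stat n w" "factor_stat n (\<sigma> # w) = s" using T(2) by blast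
      have "snd (snd t) < snd (snd s)"
        using depth_pos[of \<sigma> n] that w depth_Cons[of n \<sigma> w] by (auto simp: factor_stat_def)
      then show "(\<Sum>k | k \<in> K \<and> factor_stat n (wd k) = t. sg k) =
        (\<Sum>k | k \<in> K' \<and> factor_stat n (wd' k) = t. sg' k)" by (rule less)
    qed
    also have "\<dots> = ?f' \<sigma>"
      by (rule sum_grouped_by_stat[OF finK(2) T(1) _ T(2), symmetric]) (auto simp: T_def)
    finally show ?thesis .
  qed
  have S: "finite ?S" "id \<in> ?S" by (simp_all add: finite_permutations permutes_id)
  have "sum ?f ?S = sum ?f' ?S"
    using conjunct2[OF assms(1)[unfolded inverse_family_def], THEN spec, of s]
      conjunct2[OF assms(2)[unfolded inverse_family_def], THEN spec, of s]
    by (rule trans[OF _ sym])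
  then have "?f id + sum ?f (?S - {id}) = ?f' id + sum ?f' (?S - {id})"
    by (simp only: sum.remove[OF S])
  moreover have "sum ?f (?S - {id}) = sum ?f' (?S - {id})"
    by (rule sum.cong[OF refl step])
  ultimately show ?case by (simp add: factor_stat_id_Cons)
qed

section \<open>Inverse families from sign-reversing involutions, and the proper words\<close>

lemma sum_sign_reversing_involution:
  fixes h :: "'a \<Rightarrow> rat"
  assumes "\<And>z. z \<in> Z \<Longrightarrow> \<phi> z \<in> Z" "\<And>z. z \<in> Z \<Longrightarrow> \<phi> (\<phi> z) = z"
    and "\<And>z. z \<in> Z \<Longrightarrow> h (\<phi> z) = - h z"
  shows "sum h Z = 0"
proof -
  have "bij_betw \<phi> Z Z"
    by (rule bij_betw_byWitness[where f' = \<phi>]) (use assms in auto)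
  then have "sum h Z = (\<Sum>z\<in>Z. h (\<phi> z))"
    by (rule sum.reindex_bij_betw[symmetric])
  also have "\<dots> = - sum h Z"
    using assms(3) by (simp add: sum_negf)
  finally show ?thesis by simp
qed

text \<open>\<open>V\<close> indexes a spelling of each permutation as a word with the same
  statistic, so the product of F with the family becomes a sum over pairs in V \<times> K. Only the
  second component carries a sign. The involution cancels every pair except (v0, k0), which supplies
  the unit.\<close>

lemma inverse_familyI:
  fixes vd :: "'v \<Rightarrow> (nat \<Rightarrow> nat) list" and wd :: "'k \<Rightarrow> (nat \<Rightarrow> nat) list"
  assumes fin: "\<And>d. finite {k\<in>K. depth n (wd k) \<le> d}"
    and bij: "bij_betw (\<lambda>v. word_prod (vd v)) V {\<sigma>. \<sigma> permutes {1..n}}"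
    and vd: "\<And>v. v \<in> V \<Longrightarrow> factor_stat n [word_prod (vd v)] = factor_stat n (vd v)"
    and base: "(v0, k0) \<in> V \<times> K" "factor_stat n (vd v0 @ wd k0) = factor_stat n []" "sg k0 = 1"
    and closed: "\<And>z. z \<in> V \<times> K - {(v0, k0)} \<Longrightarrow> \<phi> z \<in> V \<times> K - {(v0, k0)}"
    and invol: "\<And>z. z \<in> V \<times> K - {(v0, k0)} \<Longrightarrow> \<phi> (\<phi> z) = z"
    and stat: "\<And>z. z \<in> V \<times> K - {(v0, k0)} \<Longrightarrow>
      factor_stat n (vd (fst (\<phi> z)) @ wd (snd (\<phi> z))) = factor_stat n (vd (fst z) @ wd (snd z))"
    and sign: "\<And>z. z \<in> V \<times> K - {(v0, k0)} \<Longrightarrow> sg (snd (\<phi> z)) = - sg (snd z)"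
  shows "inverse_family n K wd sg"
  unfolding inverse_family_def
proof (intro conjI allI)
  fix d show "finite {k\<in>K. depth n (wd k) \<le> d}" by (rule fin)
next
  fix s
  let ?z0 = "(v0, k0)"
  define Z where "Z = {(v, k). v \<in> V \<and> k \<in> K \<and> factor_stat n (vd v @ wd k) = s}"
  have finV: "finite V"
    using bij_betw_finite[OF bij] by (simp add: finite_permutations)
  have finK: "finite {k\<in>K. factor_stat n (f @ wd k) = s}" for f
    by (rule finite_subset[OF _ fin[of "snd (snd s)"]]) (auto simp: factor_stat_def depth_append)
  have eq: "factor_stat n (word_prod (vd v) # wd k) = factor_stat n (vd v @ wd k)" if "v \<in> V" for v k
    using factor_stat_append_cong[OF vd[OF that], of "wd k" "wd k"] by simp
  have Z: "Z = Sigma V (\<lambda>v. {k\<in>K. factor_stat n (vd v @ wd k) = s})"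
    by (auto simp: Z_def)
  have "(\<Sum>\<sigma> | \<sigma> permutes {1..n}. \<Sum>k | k \<in> K \<and> factor_stat n (\<sigma> # wd k) = s. sg k)
      = (\<Sum>v\<in>V. \<Sum>k | k \<in> K \<and> factor_stat n (word_prod (vd v) # wd k) = s. sg k)"
    by (rule sum.reindex_bij_betw[OF bij, symmetric])
  also have "\<dots> = (\<Sum>v\<in>V. \<Sum>k | k \<in> K \<and> factor_stat n (vd v @ wd k) = s. sg k)"
    by (rule sum.cong) (simp_all add: eq)
  also have "\<dots> = (\<Sum>z\<in>Z. sg (snd z))"
    unfolding Z by (subst sum.Sigma) (use finV finK in \<open>auto simp: case_prod_unfold\<close>)
  also have "\<dots> = (if s = factor_stat n [] then 1 else 0)"
  proof -
    have finZ: "finite Z" unfolding Z using finV finK by auto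
    have sub: "z \<in> V \<times> K - {?z0}" "factor_stat n (vd (fst z) @ wd (snd z)) = s" if "z \<in> Z - {?z0}" for z
      using that by (auto simp: Z_def)
    have "(\<Sum>z\<in>Z - {?z0}. sg (snd z)) = 0"
    proof (rule sum_sign_reversing_involution)
      fix z assume "z \<in> Z - {?z0}"
      note z = sub[OF this]
      show "\<phi> z \<in> Z - {?z0}"
        using closed[OF z(1)] stat[OF z(1)] z(2) by (auto simp: Z_def case_prod_unfold)
    qed (use sub invol sign in auto)
    moreover have "?z0 \<in> Z \<longleftrightarrow> s = factor_stat n []"
      using base by (auto simp: Z_def)
    ultimately show ?thesis
      using sum.remove[OF finZ, of ?z0 "\<lambda>z. sg (snd z)"] base(3) by (cases "?z0 \<in> Z") auto
  qed
  finally show "(\<Sum>\<sigma> | \<sigma> permutes {1..n}. \<Sum>k | k \<in> K \<and> factor_stat n (\<sigma> # wd k) = s. sg k)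
      = (if s = factor_stat n [] then 1 else 0)" .
qed

text \<open>Every letter has depth at least 1, so bounding the depth bounds the length over a finite
  alphabet.\<close>

lemma finite_words_bounded_depth:
  "finite {w. w \<in> lists ({\<sigma>. \<sigma> permutes {1..n}} - {id}) \<and> depth n w \<le> d}"
proof -
  let ?L = "{\<sigma>. \<sigma> permutes {1..n}} - {id}"
  have "length w \<le> depth n w" if "w \<in> lists ?L" for w
    using that
  proof (induction w)
    case (Cons \<sigma> w)
    then have "length w \<le> depth n w" "depth n [\<sigma>] > 0" using depth_pos[of \<sigma> n] by auto
    then show ?case using depth_Cons[of n \<sigma> w] by simp
  qed simp
  then have "{w. w \<in> lists ?L \<and> depth n w \<le> d} \<subseteq> {w. set w \<subseteq> ?L \<and> length w \<le> d}"
    using order_trans by blast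
  moreover have "finite \<dots>"
    by (rule finite_lists_length_le) (simp add: finite_permutations)
  ultimately show ?thesis using finite_subset by blast
qed

text \<open>The telescoping of F (1 - (F - 1) + (F - 1)^2 - ...) as an involution: a letter other
  than \<open>id\<close> is pushed from the slot of F onto the word, leaving \<open>id\<close>
  behind; a slot holding \<open>id\<close> takes back the head of the word.\<close>

lemma inverse_family_proper:
  "inverse_family n (lists ({\<sigma>. \<sigma> permutes {1..n}} - {id})) (\<lambda>w. w) (\<lambda>w. (-1) ^ length w)"
proof -
  define \<phi> :: "(nat \<Rightarrow> nat) \<times> (nat \<Rightarrow> nat) list \<Rightarrow> _" where
    "\<phi> = (\<lambda>(\<sigma>, w). if \<sigma> \<noteq> id then (id, \<sigma> # w) else (hd w, tl w))"
  let ?S = "{\<sigma>. \<sigma> permutes {1..n}}"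
  have cases: "(fst z \<noteq> id \<Longrightarrow> P) \<Longrightarrow> (\<And>\<sigma> w. z = (id, \<sigma> # w) \<Longrightarrow> \<sigma> \<in> ?S - {id} \<Longrightarrow> w \<in> lists (?S - {id}) \<Longrightarrow> P) \<Longrightarrow> P"
    if "z \<in> ?S \<times> lists (?S - {id}) - {(id, [])}" for z P
  proof (cases z)
    case (Pair a b)
    assume "fst z \<noteq> id \<Longrightarrow> P" "\<And>\<sigma> w. z = (id, \<sigma> # w) \<Longrightarrow> \<sigma> \<in> ?S - {id} \<Longrightarrow> w \<in> lists (?S - {id}) \<Longrightarrow> P"
    with that Pair show P by (cases b; cases "a = id") auto
  qed
  show ?thesis
  proof (rule inverse_familyI[where vd = "\<lambda>\<sigma>. [\<sigma>]" and V = ?S and \<phi> = \<phi> and ?v0.0 = id and ?k0.0 = "[]"])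
    show "finite {k \<in> lists (?S - {id}). depth n k \<le> d}" for d
      using finite_words_bounded_depth by simp
    show "bij_betw (\<lambda>v. word_prod [v]) ?S ?S" by (simp add: bij_betw_def inj_on_def)
    fix z assume z: "z \<in> ?S \<times> lists (?S - {id}) - {(id, [])}"
    show "\<phi> z \<in> ?S \<times> lists (?S - {id}) - {(id, [])}"
      using z by (rule cases) (use z in \<open>auto simp: \<phi>_def permutes_id\<close>)
    show "\<phi> (\<phi> z) = z"
      using z by (rule cases) (auto simp: \<phi>_def case_prod_unfold)
    show "factor_stat n ([fst (\<phi> z)] @ snd (\<phi> z)) = factor_stat n ([fst z] @ snd z)"
      using z by (rule cases) (auto simp: \<phi>_def case_prod_unfold factor_stat_id_Cons)
    show "(- 1) ^ length (snd (\<phi> z)) = - ((- 1) ^ length (snd z) :: rat)"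
      using z by (rule cases) (auto simp: \<phi>_def case_prod_unfold)
  qed (simp_all add: permutes_id factor_stat_id_Cons)
qed

subsection \<open>Monotone words\<close>

definition tword :: "(nat \<times> nat) list \<Rightarrow> (nat \<Rightarrow> nat) list" where
  "tword ts = map (\<lambda>(a, b). transpose a b) ts"

lemma tword_simps [simp]:
  "tword [] = []" "tword ((a, b) # ts) = transpose a b # tword ts"
  "tword (ts @ us) = tword ts @ tword us"
  by (simp_all add: tword_def)

lemma length_tword [simp]: "length (tword ts) = length ts"
  by (simp add: tword_def)

definition tpairs :: "nat \<Rightarrow> (nat \<times> nat) set" where
  "tpairs n = {(a, b). 1 \<le> a \<and> a < b \<and> b \<le> n}"

text \<open>With J_b the sum of the transpositions (a b) over a < b (a Jucys-Murphy element), these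
  words are the terms of (1 + J_n) ... (1 + J_2). The larger entry of each letter exceeds every
  point moved by the letters to its right. Inverting reverses the order of the factors, which is why
  weakly increasing words are the counterpart.\<close>

definition decreasing_words :: "nat \<Rightarrow> (nat \<times> nat) list set" where
  "decreasing_words n = {ts \<in> lists (tpairs n). sorted_wrt (>) (map snd ts)}"

definition monotone_words :: "nat \<Rightarrow> (nat \<times> nat) list set" where
  "monotone_words n = {ts \<in> lists (tpairs n). sorted (map snd ts)}"

lemma word_prod_permutes:
  "(\<And>\<sigma>. \<sigma> \<in> set f \<Longrightarrow> \<sigma> permutes S) \<Longrightarrow> word_prod f permutes S"
  by (induction f) (auto intro: permutes_compose permutes_id)

lemma tword_permutes: "ts \<in> lists (tpairs n) \<Longrightarrow> \<sigma> \<in> set (tword ts) \<Longrightarrow> \<sigma> permutes {1..n}"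
  by (fastforce simp: tword_def tpairs_def intro: permutes_swap_id)

lemma tword_lists_nonid:
  "ts \<in> lists (tpairs n) \<Longrightarrow> tword ts \<in> lists ({\<sigma>. \<sigma> permutes {1..n}} - {id})"
proof (induction ts)
  case (Cons p ts)
  obtain a b where p: "p = (a, b)" by (cases p)
  have "a \<noteq> b" "a \<in> {1..n}" "b \<in> {1..n}" using Cons.prems p by (auto simp: tpairs_def)
  then have "transpose a b \<in> {\<sigma>. \<sigma> permutes {1..n}} - {id}"
    by (simp add: transpose_eq_id_iff permutes_swap_id)
  then show ?case using Cons.IH Cons.prems unfolding p tword_simps Cons_in_lists_iff by blast
qed simp

text \<open>A transposition determines its pair once the larger entry is put second. Hence
  factorizations can be counted as lists of pairs.\<close>

lemma inj_on_tword: "inj_on tword (lists (tpairs n))"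
proof -
  have "inj_on (\<lambda>(a, b). transpose a b) (tpairs n)"
  proof (rule inj_onI)
    fix p q assume pq: "p \<in> tpairs n" "q \<in> tpairs n"
      "(case p of (a, b) \<Rightarrow> transpose a b) = (case q of (a, b) \<Rightarrow> transpose a b)"
    obtain a b c d where ab: "p = (a, b)" "q = (c, d)" by (cases p, cases q)
    have "transpose a b b = transpose c d b" "transpose a b a = transpose c d a"
      using pq(3) ab by simp_all
    then show "p = q" using pq(1,2) ab by (auto simp: tpairs_def transpose_def split: if_splits)
  qed
  then show ?thesis
    unfolding tword_def[abs_def] by (rule inj_on_mapI[OF inj_on_subset]) auto
qed

lemma word_prod_tword_fixes:
  assumes "\<And>p. p \<in> set ts \<Longrightarrow> fst p < snd p \<and> snd p < x"
  shows "word_prod (tword ts) x = x"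
  using assms
proof (induction ts)
  case (Cons p ts)
  then have "word_prod (tword ts) x = x" "fst p < snd p \<and> snd p < x" by auto
  then show ?case by (cases p) simp
qed simp

lemma decreasing_words_Cons:
  "(a, b) # ts \<in> decreasing_words n \<longleftrightarrow>
     (a, b) \<in> tpairs n \<and> ts \<in> decreasing_words n \<and> (\<forall>p\<in>set ts. snd p < b)"
  by (auto simp: decreasing_words_def)

lemma decreasing_word_fixes:
  assumes "ts \<in> decreasing_words n" "\<And>p. p \<in> set ts \<Longrightarrow> snd p < x"
  shows "word_prod (tword ts) x = x"
proof (rule word_prod_tword_fixes)
  fix p assume "p \<in> set ts"
  then show "fst p < snd p \<and> snd p < x"
    using assms by (cases p) (auto simp: decreasing_words_def tpairs_def)
qed

text \<open>Each letter meets a product of later letters that fixes its larger entry, so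
  \<open>transpose_stat\<close> applies letter by letter.\<close>

lemma factor_stat_decreasing_word:
  assumes "ts \<in> decreasing_words n"
  shows "factor_stat n [word_prod (tword ts)] = factor_stat n (tword ts)"
  using assms
proof (induction ts)
  case Nil
  show ?case
    using factor_stat_id_Cons[of n "[]"] by (simp only: tword_simps word_prod_simps)
next
  case (Cons p ts)
  obtain a b where p: "p = (a, b)" by (cases p)
  let ?\<tau> = "word_prod (tword ts)"
  have ts: "ts \<in> decreasing_words n" and ab: "1 \<le> a" "a < b" "b \<le> n" and lt: "\<forall>p\<in>set ts. snd p < b"
    using Cons.prems p by (auto simp: decreasing_words_Cons tpairs_def)
  have perm: "?\<tau> permutes {1..n}"
    by (rule word_prod_permutes, rule tword_permutes[of ts])
      (use ts in \<open>simp_all add: decreasing_words_def\<close>)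
  have fix_b: "?\<tau> b = b" by (rule decreasing_word_fixes[OF ts]) (use lt in auto)
  have "factor_stat n [transpose a b \<circ> ?\<tau>] = factor_stat n [transpose a b, ?\<tau>]"
    using ab by (intro transpose_stat[OF perm fix_b]) auto
  also have "\<dots> = factor_stat n (transpose a b # tword ts)"
    by (rule factor_stat_Cons_cong) (rule Cons.IH[OF ts])
  finally show ?case by (simp only: p tword_simps word_prod_simps)
qed

lemma depth_tword:
  assumes "ts \<in> lists (tpairs n)"
  shows "depth n (tword ts) = length ts"
  using assms
proof (induction ts)
  case (Cons p ts)
  obtain a b where p: "p = (a, b)" by (cases p)
  have "depth n [transpose a b] = 1"
    using transpose_comp_fixing(2)[OF permutes_id, where a = a and b = b and n = n] Cons.hyps depth_id[of n] p
    by (simp add: tpairs_def)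
  then show ?case using Cons.IH depth_Cons[of n "transpose a b" "tword ts"] by (simp add: p)
qed simp

text \<open>The largest point moved by the product is the larger entry b of the first letter, and
  its image is the smaller entry a. So the first letter can be read off from the permutation, and
  the rest follows by cancellation. Conversely, a permutation is spelled by straightening out its
  points from the largest down.\<close>

lemma bij_betw_decreasing_words:
  "bij_betw (\<lambda>ts. word_prod (tword ts)) (decreasing_words n) {\<sigma>. \<sigma> permutes {1..n}}"
proof -
  let ?f = "\<lambda>ts. word_prod (tword ts)"
  have top: "{x. ?f ((a, b) # ts) x \<noteq> x} \<subseteq> {..b}" "?f ((a, b) # ts) b = a" "a < b"
    if "(a, b) # ts \<in> decreasing_words n" for a b ts
  proof -
    have d: "(a, b) \<in> tpairs n" "ts \<in> decreasing_words n" "\<forall>p\<in>set ts. snd p < b"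
      using that by (auto simp: decreasing_words_Cons)
    have fx: "?f ts x = x" if "b \<le> x" for x
      by (rule decreasing_word_fixes[OF d(2)]) (use d(3) that in fastforce)
    show "a < b" using d(1) by (simp add: tpairs_def)
    show "?f ((a, b) # ts) b = a" using fx[of b] by simp
    show "{x. ?f ((a, b) # ts) x \<noteq> x} \<subseteq> {..b}"
    proof
      fix x assume "x \<in> {x. ?f ((a, b) # ts) x \<noteq> x}"
      moreover have "?f ((a, b) # ts) x = x" if "b < x"
        using fx[of x] that \<open>a < b\<close> by (simp add: transpose_def)
      ultimately show "x \<in> {..b}" by (auto simp: not_le[symmetric])
    qed
  qed
  have inj: "ts = us" if "ts \<in> decreasing_words n" "us \<in> decreasing_words n" "?f ts = ?f us" for ts us
    using that
  proof (induction ts arbitrary: us)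
    case Nil
    show ?case
    proof (cases us)
      case (Cons p us')
      obtain a b where p: "p = (a, b)" by (cases p)
      have "?f us b = a" "a < b" using top(2,3) Nil.prems(2) Cons p by auto
      moreover have "?f us b = b" using Nil.prems(3)[symmetric] by (simp only: tword_simps word_prod_simps id_apply)
      ultimately show ?thesis by simp
    qed simp
  next
    case (Cons p ts)
    obtain a b where p: "p = (a, b)" by (cases p)
    show ?case
    proof (cases us)
      case Nil
      have "?f (p # ts) b = a" "a < b" using top(2,3) Cons.prems(1) p by auto
      moreover have "?f (p # ts) b = b"
        using Cons.prems(3) Nil by (simp only: tword_simps word_prod_simps id_apply)
      ultimately show ?thesis by simp
    next
      case us: (Cons q us')
      obtain c d where q: "q = (c, d)" by (cases q)
      note t1 = top[OF Cons.prems(1)[unfolded p]] and t2 = top[OF Cons.prems(2)[unfolded us q]]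
      have eq: "?f ((a, b) # ts) = ?f ((c, d) # us')" using Cons.prems(3) unfolding p q us .
      have "?f ((c, d) # us') b \<noteq> b" using t1(2,3) unfolding eq by linarith
      then have "b \<in> {..d}" using t2(1) by blast
      moreover have "?f ((a, b) # ts) d \<noteq> d" using t2(2,3) unfolding eq by linarith
      then have "d \<in> {..b}" using t1(1) by blast
      ultimately have bd: "b = d" by simp
      then have ac: "a = c" using t1(2) t2(2) unfolding eq by simp
      have "transpose a b \<circ> ?f ts = transpose a b \<circ> ?f us'"
        using eq unfolding ac bd tword_simps word_prod_simps .
      then have "?f ts = ?f us'"
        unfolding fun_eq_iff comp_apply by (metis transpose_involutory)
      then have "ts = us'"
        using Cons.prems(1,2) p q us by (intro Cons.IH) (simp_all add: decreasing_words_Cons)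
      then show ?thesis using p q us ac bd by simp
    qed
  qed
  \<comment> \<open>The bound m on the larger entries is carried along so that a letter with larger
    entry \<open>Suc m\<close> may be put in front.\<close>
  have surj: "\<exists>ts\<in>decreasing_words n. (\<forall>p\<in>set ts. snd p \<le> m) \<and> ?f ts = \<sigma>"
    if "\<sigma> permutes {1..m}" "m \<le> n" for \<sigma> m
    using that
  proof (induction m arbitrary: \<sigma>)
    case 0
    then have "\<sigma> = id" by (simp add: permutes_empty)
    then show ?case by (intro bexI[of _ "[]"]) (auto simp: decreasing_words_def)
  next
    case (Suc m)
    let ?b = "Suc m"
    \<comment> \<open>Multiplying by the transposition of \<open>Suc m\<close> with its image makes
      \<open>Suc m\<close> a fixed point. If it was one already, that transposition is trivial and
      no letter is added.\<close>
    define a where "a = \<sigma> ?b"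
    have a: "a \<in> {1..?b}" using permutes_in_image[OF Suc.prems(1)] by (simp add: a_def)
    define \<tau> where "\<tau> = transpose a ?b \<circ> \<sigma>"
    have perm: "\<tau> permutes {1..?b}"
      unfolding \<tau>_def using a by (intro permutes_compose[OF Suc.prems(1)] permutes_swap_id) auto
    have "\<tau> ?b = ?b" by (simp add: \<tau>_def a_def)
    then have "\<tau> permutes {1..m}"
      using perm by (auto intro!: permutes_superset[OF perm] simp: le_Suc_eq)
    then obtain ts where ts: "ts \<in> decreasing_words n" "\<forall>p\<in>set ts. snd p \<le> m" "?f ts = \<tau>"
      using Suc.IH Suc.prems(2) by auto
    have \<sigma>: "\<sigma> = transpose a ?b \<circ> \<tau>" by (simp add: \<tau>_def comp_assoc[symmetric])
    show ?case
    proof (cases "a = ?b")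
      case True
      then show ?thesis using ts \<sigma> by (intro bexI[of _ ts]) auto
    next
      case False
      then have "(a, ?b) # ts \<in> decreasing_words n"
        using ts a Suc.prems(2) by (auto simp: decreasing_words_Cons tpairs_def)
      then show ?thesis
        using ts \<sigma> by (intro bexI[of _ "(a, ?b) # ts"]) (auto)
    qed
  qed
  show ?thesis
  proof (rule bij_betwI')
    fix ts us assume "ts \<in> decreasing_words n" "us \<in> decreasing_words n"
    then show "?f ts = ?f us \<longleftrightarrow> ts = us" using inj by blast
  next
    fix ts assume "ts \<in> decreasing_words n"
    then have "ts \<in> lists (tpairs n)" by (simp add: decreasing_words_def)
    then show "?f ts \<in> {\<sigma>. \<sigma> permutes {1..n}}"
      using tword_permutes by (auto intro!: word_prod_permutes)
  next
    fix \<sigma> assume "\<sigma> \<in> {\<sigma>. \<sigma> permutes {1..n}}"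
    then show "\<exists>ts\<in>decreasing_words n. \<sigma> = ?f ts" using surj[of \<sigma> n] by blast
  qed
qed

text \<open>The involution moves one letter across the gap between a decreasing and a monotone word.\<close>

lemma inverse_family_monotone:
  "inverse_family n (monotone_words n) tword (\<lambda>ts. (-1) ^ length ts)"
proof -
  let ?V = "decreasing_words n" and ?K = "monotone_words n"
  \<comment> \<open>The weak comparison decides the direction: if it holds, the last letter of v may
    start the monotone word. If it fails with both words nonempty, the head of w is strictly smaller
    and may end the decreasing word. After a move the comparison at the new gap points back, which
    makes this an involution; it is stuck only at two empty words.\<close>
  define \<phi> :: "(nat \<times> nat) list \<times> (nat \<times> nat) list \<Rightarrow> _" where
    "\<phi> = (\<lambda>(v, w). if v \<noteq> [] \<and> (w = [] \<or> snd (last v) \<le> snd (hd w))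
       then (butlast v, last v # w) else (v @ [hd w], tl w))"
  have cases: P
    if z: "z \<in> ?V \<times> ?K - {([], [])}"
    and 1: "\<And>v t w. z = (v @ [t], w) \<Longrightarrow> \<phi> z = (v, t # w) \<Longrightarrow> \<phi> (v, t # w) = z \<Longrightarrow>
       v \<in> ?V \<Longrightarrow> t # w \<in> ?K \<Longrightarrow> P"
    and 2: "\<And>v t w. z = (v, t # w) \<Longrightarrow> \<phi> z = (v @ [t], w) \<Longrightarrow> \<phi> (v @ [t], w) = z \<Longrightarrow>
       v @ [t] \<in> ?V \<Longrightarrow> w \<in> ?K \<Longrightarrow> P" for z P
  proof -
    obtain v w where vw: "z = (v, w)" by (cases z)
    then have mem: "v \<in> ?V" "w \<in> ?K" "\<not> (v = [] \<and> w = [])" using z by auto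
    show P
    proof (cases "v \<noteq> [] \<and> (w = [] \<or> snd (last v) \<le> snd (hd w))")
      case True
      then obtain u t where v: "v = u @ [t]" by (metis rev_exhaust)
      have u: "u \<in> ?V" "\<And>p. p \<in> set u \<Longrightarrow> snd t < snd p" "t \<in> tpairs n"
        using mem(1) v by (auto simp: decreasing_words_def sorted_wrt_append)
      have k: "t # w \<in> ?K"
      proof (cases w)
        case (Cons q w')
        then have "snd t \<le> snd q" using True v by simp
        then show ?thesis using mem(2) Cons u(3) by (fastforce simp: monotone_words_def)
      qed (use u in \<open>simp add: monotone_words_def\<close>)
      have "\<phi> (u, t # w) = z"
        using u(2)[of "last u"] by (auto simp: \<phi>_def vw v)
      with True show P using 1[of u t w] vw v u k by (simp add: \<phi>_def)
    next
      case False
      then obtain t w' where w: "w = t # w'" using mem(3) by (cases w) auto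
      have lt: "snd t < snd (last v)" if "v \<noteq> []" using False that w by auto
      have w': "w' \<in> ?K" "t \<in> tpairs n" "\<And>p. p \<in> set w' \<Longrightarrow> snd t \<le> snd p"
        using mem(2) w by (auto simp: monotone_words_def)
      have k: "v @ [t] \<in> ?V"
      proof (cases v rule: rev_cases)
        case (snoc u q)
        then have "snd t < snd q" using lt by simp
        then show ?thesis using mem(1) snoc w'(2)
          by (fastforce simp: decreasing_words_def sorted_wrt_append)
      qed (use w' in \<open>simp add: decreasing_words_def\<close>)
      have "\<phi> (v @ [t], w') = z"
        using w'(3)[of "hd w'"] by (cases w') (auto simp: \<phi>_def vw w)
      with False show P using 2[of v t w'] vw w w' k by (auto simp: \<phi>_def)
    qed
  qed
  show ?thesis
  proof (rule inverse_familyI[where vd = tword and V = ?V and \<phi> = \<phi> and ?v0.0 = "[]" and ?k0.0 = "[]"])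
    fix d
    have "tword ` {ts \<in> ?K. depth n (tword ts) \<le> d} \<subseteq>
      {w. w \<in> lists ({\<sigma>. \<sigma> permutes {1..n}} - {id}) \<and> depth n w \<le> d}"
      using tword_lists_nonid by (fastforce simp: monotone_words_def)
    then have "finite (tword ` {ts \<in> ?K. depth n (tword ts) \<le> d})"
      using finite_words_bounded_depth finite_subset by blast
    then show "finite {ts \<in> ?K. depth n (tword ts) \<le> d}"
      by (rule finite_imageD) (auto intro: inj_on_subset[OF inj_on_tword] simp: monotone_words_def)
  next
    fix z assume z: "z \<in> ?V \<times> ?K - {([], [])}"
    show "\<phi> z \<in> ?V \<times> ?K - {([], [])}" using z by (rule cases) auto
    show "\<phi> (\<phi> z) = z" using z by (rule cases) auto
    show "factor_stat n (tword (fst (\<phi> z)) @ tword (snd (\<phi> z))) =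
      factor_stat n (tword (fst z) @ tword (snd z))"
      using z by (rule cases) auto
    show "(- 1) ^ length (snd (\<phi> z)) = - ((- 1) ^ length (snd z) :: rat)"
      using z by (rule cases) auto
  next
    show "factor_stat n [word_prod (tword v)] = factor_stat n (tword v)" if "v \<in> ?V" for v
      using factor_stat_decreasing_word that .
  qed (rule bij_betw_decreasing_words,
      simp_all only: tword_simps append_Nil list.size power_0 SigmaI,
      simp add: decreasing_words_def monotone_words_def)
qed

subsection \<open>Words modulo commutation of disjoint letters\<close>

abbreviation swaps (infix "\<approx>" 50) where "f \<approx> g \<equiv> swap_step\<^sup>*\<^sup>* f g"

lemma disjoint_perms_commute: "disjoint_perms \<sigma> \<tau> \<longleftrightarrow> disjoint_perms \<tau> \<sigma>"
  by (auto simp: disjoint_perms_def)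

lemma disjoint_perms_self_iff: "disjoint_perms \<sigma> \<sigma> \<longleftrightarrow> \<sigma> = id"
  by (auto simp: disjoint_perms_def fun_eq_iff)

lemma swap_step_sym: "swap_step f g \<Longrightarrow> swap_step g f"
  by (auto elim!: swap_step.cases intro: swap_step.intros simp: disjoint_perms_commute)

lemma swaps_sym: "f \<approx> g \<Longrightarrow> g \<approx> f"
  using sympD[OF symp_rtranclp] swap_step_sym by (metis sympI)

lemma swap_step_context: "swap_step f g \<Longrightarrow> swap_step (u @ f @ v) (u @ g @ v)"
proof (induction rule: swap_step.induct)
  case (1 \<sigma> \<tau> xs ys)
  then show ?case using swap_step.intros[of \<sigma> \<tau> "u @ xs" "ys @ v"] by simp
qed

lemma swaps_context: "f \<approx> g \<Longrightarrow> u @ f @ v \<approx> u @ g @ v"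
  by (induction rule: rtranclp_induct) (auto intro: swap_step_context rtranclp.rtrancl_into_rtrancl)

lemma swaps_append: "f \<approx> f' \<Longrightarrow> g \<approx> g' \<Longrightarrow> f @ g \<approx> f' @ g'"
  using swaps_context[of f f' "[]" g] swaps_context[of g g' f' "[]"] by (simp add: rtranclp_trans)

lemma swaps_Cons: "f \<approx> g \<Longrightarrow> \<sigma> # f \<approx> \<sigma> # g"
  using swaps_append[of "[\<sigma>]" "[\<sigma>]" f g] by simp

lemma swap_step_mset: "swap_step f g \<Longrightarrow> mset f = mset g"
  by (induction rule: swap_step.induct) simp

lemma swaps_mset: "f \<approx> g \<Longrightarrow> mset f = mset g"
  by (induction rule: rtranclp_induct) (simp_all add: swap_step_mset)

lemma swaps_set: "f \<approx> g \<Longrightarrow> set f = set g"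
  by (metis swaps_mset set_mset_mset)

lemma swaps_length: "f \<approx> g \<Longrightarrow> length f = length g"
  by (metis swaps_mset size_mset)

lemma swaps_move_front:
  "(\<And>\<tau>. \<tau> \<in> set x \<Longrightarrow> disjoint_perms \<sigma> \<tau>) \<Longrightarrow> x @ \<sigma> # y \<approx> \<sigma> # x @ y"
proof (induction x)
  case (Cons \<tau> x)
  then have "\<tau> # x @ \<sigma> # y \<approx> \<tau> # \<sigma> # x @ y" by (intro swaps_Cons) simp
  moreover have "swap_step (\<tau> # \<sigma> # x @ y) (\<sigma> # \<tau> # x @ y)"
    using swap_step.intros[of \<tau> \<sigma> "[]" "x @ y"] Cons.prems by (simp add: disjoint_perms_commute)
  ultimately show ?case by simp
qed simp

text \<open>Projections to pairs of dependent letters are a complete invariant.\<close>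

definition same_projections :: "('a \<Rightarrow> 'a) list \<Rightarrow> ('a \<Rightarrow> 'a) list \<Rightarrow> bool" where
  "same_projections f g \<longleftrightarrow>
     (\<forall>\<sigma> \<tau>. \<not> disjoint_perms \<sigma> \<tau> \<longrightarrow> filter (\<lambda>x. x = \<sigma> \<or> x = \<tau>) f = filter (\<lambda>x. x = \<sigma> \<or> x = \<tau>) g)"

lemma swaps_imp_same_projections: "f \<approx> g \<Longrightarrow> same_projections f g"
proof (induction rule: rtranclp_induct)
  case (step g h)
  from step(2) have "same_projections g h"
    by cases (auto simp: same_projections_def disjoint_perms_commute)
  with step(3) show ?case by (simp add: same_projections_def)
qed (simp add: same_projections_def)

text \<open>Brings \<sigma> to the front of \<open>g\<close>. The identity is excluded because it is
  disjoint from every letter, itself included, so that no projection records it.\<close>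

lemma same_projections_Cons_split:
  assumes "same_projections (\<sigma> # u) g" "\<sigma> \<noteq> id"
  obtains x y where "g = x @ \<sigma> # y" "\<sigma> \<notin> set x" "\<And>\<tau>. \<tau> \<in> set x \<Longrightarrow> disjoint_perms \<sigma> \<tau>"
    "same_projections u (x @ y)"
proof -
  have "filter (\<lambda>x. x = \<sigma> \<or> x = \<sigma>) (\<sigma> # u) = filter (\<lambda>x. x = \<sigma> \<or> x = \<sigma>) g"
    using assms disjoint_perms_self_iff[of \<sigma>] unfolding same_projections_def by blast
  then have "\<sigma> \<in> set (filter (\<lambda>x. x = \<sigma> \<or> x = \<sigma>) g)" by (metis (mono_tags) filter.simps(2) list.set_intros(1))
  then have "\<sigma> \<in> set g" by simp
  then obtain x y where g: "g = x @ \<sigma> # y" "\<sigma> \<notin> set x" by (meson split_list_first)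
  \<comment> \<open>A letter \<tau> dependent on \<sigma> and placed before the first \<sigma> of
    \<open>g\<close> would make the projection of \<open>g\<close> to this pair start with a letter
    other than \<sigma>, whereas that of \<open>\<sigma> # u\<close> starts with \<sigma>.\<close>
  have disj: "disjoint_perms \<sigma> \<tau>" if "\<tau> \<in> set x" for \<tau>
  proof (rule ccontr)
    assume "\<not> disjoint_perms \<sigma> \<tau>"
    let ?p = "filter (\<lambda>x. x = \<sigma> \<or> x = \<tau>)"
    have eq: "\<sigma> # ?p u = ?p x @ \<sigma> # ?p y"
      using assms(1) \<open>\<not> disjoint_perms \<sigma> \<tau>\<close> g by (force simp: same_projections_def)
    have "\<tau> \<in> set (?p x)" using that by simp
    then obtain a l where a: "?p x = a # l" by (cases "?p x") auto
    then have "a \<in> set (?p x)" by simp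
    then have "a \<in> set x" by simp
    moreover have "a = \<sigma>" using eq a by simp
    ultimately show False using g(2) by simp
  qed
  have "same_projections (\<sigma> # u) (\<sigma> # x @ y)"
    using assms(1) swaps_imp_same_projections[OF swaps_move_front[of x \<sigma> y]] disj g(1)
    by (simp add: same_projections_def)
  then have "same_projections u (x @ y)"
    unfolding same_projections_def by (simp split: if_splits) blast
  with g disj show thesis by (rule that)
qed

text \<open>The first letter of \<open>f\<close> can be swapped to the front of \<open>g\<close> and
  cancelled from all projections.\<close>

lemma same_projections_imp_swaps:
  assumes "same_projections f g" "id \<notin> set f" "id \<notin> set g"
  shows "f \<approx> g"
  using assms
proof (induction f arbitrary: g)
  case Nil
  have "\<tau> \<notin> set g" for \<tau>
  proof
    assume \<tau>: "\<tau> \<in> set g"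
    then have dep: "\<not> disjoint_perms \<tau> \<tau>" using Nil.prems(3) disjoint_perms_self_iff by metis
    have "filter (\<lambda>x. x = \<tau> \<or> x = \<tau>) g = []"
      using Nil.prems(1)[unfolded same_projections_def, rule_format, OF dep] by simp
    then show False using \<tau> unfolding filter_empty_conv by blast
  qed
  then have "g = []" by (cases g) auto
  then show ?case by simp
next
  case (Cons \<sigma> u)
  have "\<sigma> \<noteq> id" using Cons.prems(2) by auto
  then obtain x y where g: "g = x @ \<sigma> # y" "\<And>\<tau>. \<tau> \<in> set x \<Longrightarrow> disjoint_perms \<sigma> \<tau>"
    "same_projections u (x @ y)"
    using same_projections_Cons_split[OF Cons.prems(1)] by metis
  have "u \<approx> x @ y" by (rule Cons.IH) (use g Cons.prems in auto)
  then have "\<sigma> # u \<approx> \<sigma> # x @ y" by (rule swaps_Cons)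
  also have "\<sigma> # x @ y \<approx> g" using swaps_sym[OF swaps_move_front] g by blast
  finally show ?case .
qed

text \<open>Left cancellation. It is not visible from a chain of swaps, which may carry \<sigma>
  back and forth; passing through the projections avoids following the chain.\<close>

lemma swaps_Cons_split:
  assumes "\<sigma> # u \<approx> g" "id \<notin> set g"
  obtains x y where "g = x @ \<sigma> # y" "\<sigma> \<notin> set x" "\<And>\<tau>. \<tau> \<in> set x \<Longrightarrow> disjoint_perms \<sigma> \<tau>" "u \<approx> x @ y"
proof -
  have "\<sigma> \<noteq> id" "id \<notin> set u" using swaps_set[OF assms(1)] assms(2) by auto
  with same_projections_Cons_split[OF swaps_imp_same_projections[OF assms(1)]]
  obtain x y where xy: "g = x @ \<sigma> # y" "\<sigma> \<notin> set x" "\<And>\<tau>. \<tau> \<in> set x \<Longrightarrow> disjoint_perms \<sigma> \<tau>"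
    "same_projections u (x @ y)" by metis
  have "u \<approx> x @ y"
    by (rule same_projections_imp_swaps) (use xy \<open>id \<notin> set u\<close> assms(2) in auto)
  with xy show thesis using that by blast
qed

lemma swaps_Cons_imp_remove1:
  assumes "\<sigma> # u \<approx> g" "id \<notin> set g"
  shows "u \<approx> remove1 \<sigma> g"
  using swaps_Cons_split[OF assms] by (metis remove1_append remove1.simps(2))

text \<open>Serves the toggle below with \<open>v\<close> a listing of a clique: a possible first
  letter \<sigma> of the whole word that is not in the clique commutes past all of it, so it is a
  possible first letter of \<open>t\<close> and can join the clique.\<close>

lemma swaps_first_letter:
  assumes "\<sigma> # u \<approx> v @ t" "id \<notin> set (v @ t)" "\<sigma> \<notin> set v"
  shows "\<And>\<tau>. \<tau> \<in> set v \<Longrightarrow> disjoint_perms \<sigma> \<tau>" and "\<sigma> # remove1 \<sigma> t \<approx> t" and "\<sigma> \<in> set t"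
proof -
  obtain x y where g: "v @ t = x @ \<sigma> # y" "\<sigma> \<notin> set x" "\<And>\<tau>. \<tau> \<in> set x \<Longrightarrow> disjoint_perms \<sigma> \<tau>"
    using swaps_Cons_split[OF assms(1,2)] by metis
  have "\<sigma> \<in> set (v @ t)" using g(1) by simp
  then show "\<sigma> \<in> set t" using assms(3) by simp
  then obtain x' y' where t: "t = x' @ \<sigma> # y'" "\<sigma> \<notin> set x'" by (meson split_list_first)
  have first: "takeWhile (\<lambda>a. a \<noteq> \<sigma>) (z @ \<sigma> # w) = z" if "\<sigma> \<notin> set z" for z w
    using that by (induction z) auto
  have "v @ t = (v @ x') @ \<sigma> # y'" "\<sigma> \<notin> set (v @ x')" using t assms(3) by simp_all
  then have "x = v @ x'" using first g(1,2) by metis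
  with g(3) show "\<And>\<tau>. \<tau> \<in> set v \<Longrightarrow> disjoint_perms \<sigma> \<tau>" by simp
  have "t \<approx> \<sigma> # x' @ y'" unfolding t(1) by (rule swaps_move_front) (use g(3) \<open>x = v @ x'\<close> in simp)
  then show "\<sigma> # remove1 \<sigma> t \<approx> t" using t by (simp add: remove1_append swaps_sym)
qed

text \<open>A projection to a dependent pair contains at most one letter, so the order is invisible
  to it. This makes the arbitrary listing of a clique harmless.\<close>

lemma swaps_distinct_pairwise_disjoint:
  assumes "distinct f" "distinct g" "set f = set g" "id \<notin> set f" "pairwise disjoint_perms (set f)"
  shows "f \<approx> g"
proof (rule same_projections_imp_swaps)
  show "same_projections f g"
    unfolding same_projections_def
  proof (intro allI impI)
    fix \<sigma> \<tau> :: "'a \<Rightarrow> 'a" assume "\<not> disjoint_perms \<sigma> \<tau>"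
    let ?p = "filter (\<lambda>x. x = \<sigma> \<or> x = \<tau>)"
    have set_eq: "set (?p f) = set (?p g)" using assms(3) by auto
    have "card (set (?p f)) \<le> 1"
    proof (cases "\<sigma> \<in> set f")
      case True
      then have "set (?p f) \<subseteq> {\<sigma>}"
        using assms(5) \<open>\<not> disjoint_perms \<sigma> \<tau>\<close> by (auto simp: pairwise_def)
      then show ?thesis using card_mono[of "{\<sigma>}"] by fastforce
    next
      case False
      then have "set (?p f) \<subseteq> {\<tau>}" by auto
      then show ?thesis using card_mono[of "{\<tau>}"] by fastforce
    qed
    moreover have "distinct (?p f)" "distinct (?p g)" using assms(1,2) by simp_all
    ultimately have len: "length (?p f) \<le> 1" "length (?p g) \<le> 1"
      using set_eq by (metis distinct_card)+
    show "?p f = ?p g"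
    proof (cases "?p f")
      case Nil
      then show ?thesis using set_eq by simp
    next
      case (Cons a l)
      then have "?p f = [a]" using len(1) by simp
      moreover obtain b m where "?p g = b # m" using Cons set_eq by (cases "?p g") auto
      then have "?p g = [b]" using len(2) by simp
      ultimately show ?thesis using set_eq by simp
    qed
  qed
qed (use assms in auto)

section \<open>Representatives of the commutation classes\<close>

definition normal_form :: "('a \<Rightarrow> 'a) list \<Rightarrow> ('a \<Rightarrow> 'a) list" where
  "normal_form f = (SOME g. f \<approx> g)"

lemma swaps_normal_form: "f \<approx> normal_form f"
  unfolding normal_form_def by (rule someI[of _ f]) simp

text \<open>Equivalent words hand the same predicate to \<open>SOME\<close>. An arbitrary but
  class-invariant choice suffices; it turns classes into lists, to which the notion of an inverse
  family applies.\<close>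

lemma normal_form_cong: "f \<approx> g \<Longrightarrow> normal_form f = normal_form g"
proof -
  assume "f \<approx> g"
  then have "(\<lambda>h. f \<approx> h) = (\<lambda>h. g \<approx> h)"
    using swaps_sym by (intro ext iffI) (blast intro: rtranclp_trans)+
  then show ?thesis by (simp add: normal_form_def)
qed

lemma normal_form_idem [simp]: "normal_form (normal_form f) = normal_form f"
  using normal_form_cong[OF swaps_normal_form] by metis

lemma set_normal_form [simp]: "set (normal_form f) = set f"
  using swaps_set[OF swaps_normal_form] by metis

lemma length_normal_form [simp]: "length (normal_form f) = length f"
  using swaps_length[OF swaps_normal_form] by metis

subsection \<open>Cycles of a permutation as a set of disjoint letters\<close>

definition cycles :: "nat \<Rightarrow> (nat \<Rightarrow> nat) set" where
  "cycles n = {\<sigma>. nontrivial_cycle n \<sigma>}"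

text \<open>Cliques of the commutation graph on the cycles. In the Cartier-Foata identity the signs
  usually sit on the cliques; here they sit on the words, so that the cliques sum to F.\<close>

definition cliques :: "nat \<Rightarrow> (nat \<Rightarrow> nat) set set" where
  "cliques n = {S. S \<subseteq> cycles n \<and> pairwise disjoint_perms S}"

lemma cycle_of_list_moves:
  assumes "distinct cs" "2 \<le> length cs" "x \<in> set cs"
  shows "cycle_of_list cs x \<noteq> x"
proof -
  obtain i where i: "i < length cs" "x = cs ! i" using assms(3) by (metis in_set_conv_nth)
  have "cycle_of_list cs x = map (cycle_of_list cs ^^ 1) cs ! i" using i by simp
  also have "\<dots> = rotate 1 cs ! i" by (simp only: cyclic_rotation[OF assms(1)])
  also have "\<dots> = cs ! (Suc i mod length cs)" using nth_rotate[OF i(1), of 1] by simp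
  finally have *: "cycle_of_list cs x = cs ! (Suc i mod length cs)" .
  have "Suc i mod length cs \<noteq> i"
    using i assms(2) by (cases "Suc i = length cs") auto
  moreover have "Suc i mod length cs < length cs"
    using assms(2) by (intro mod_less_divisor) linarith
  ultimately show ?thesis
    using * i assms(1) nth_eq_iff_index_eq by metis
qed

lemma cycle_of_list_reaches:
  assumes "distinct cs" "x \<in> set cs" "y \<in> set cs"
  shows "\<exists>k. y = (cycle_of_list cs ^^ k) x"
proof -
  obtain i j where i: "i < length cs" "x = cs ! i" and j: "j < length cs" "y = cs ! j"
    using assms(2,3) by (metis in_set_conv_nth)
  let ?k = "j + (length cs - i)"
  have "(cycle_of_list cs ^^ ?k) x = map (cycle_of_list cs ^^ ?k) cs ! i" using i by simp
  also have "\<dots> = cs ! ((?k + i) mod length cs)"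
    using i by (simp only: cyclic_rotation[OF assms(1)] nth_rotate)
  also have "(?k + i) mod length cs = j" using i j by simp
  finally show ?thesis using j by metis
qed

lemma cyclesE:
  assumes "\<sigma> \<in> cycles n"
  obtains cs where "distinct cs" "2 \<le> length cs" "set cs \<subseteq> {1..n}" "\<sigma> = cycle_of_list cs"
    "{x. \<sigma> x \<noteq> x} = set cs"
proof -
  obtain cs where cs: "distinct cs" "2 \<le> length cs" "set cs \<subseteq> {1..n}" "\<sigma> = cycle_of_list cs"
    using assms by (auto simp: cycles_def nontrivial_cycle_def)
  moreover have "{x. \<sigma> x \<noteq> x} = set cs"
    using cycle_of_list_moves[OF cs(1,2)] id_outside_supp cs(4) by fastforce
  ultimately show thesis by (rule that)
qed

lemma cycles_permutes: "\<sigma> \<in> cycles n \<Longrightarrow> \<sigma> permutes {1..n}"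
  by (elim cyclesE) (auto intro: permutes_subset[OF cycle_permutes])

lemma cycles_not_id: "\<sigma> \<in> cycles n \<Longrightarrow> \<sigma> \<noteq> id"
proof -
  assume "\<sigma> \<in> cycles n"
  then obtain cs where cs: "2 \<le> length cs" "{x. \<sigma> x \<noteq> x} = set cs" by (metis cyclesE)
  then have "{x. \<sigma> x \<noteq> x} \<noteq> {}" by auto
  then show ?thesis by auto
qed

lemma cycles_subset: "cycles n \<subseteq> {\<sigma>. \<sigma> permutes {1..n}} - {id}"
  using cycles_permutes cycles_not_id by blast

lemma finite_cycles: "finite (cycles n)"
  by (rule finite_subset[OF cycles_subset]) (simp add: finite_permutations)

text \<open>A cycle that moves x and agrees with \<pi> wherever it moves a point has the forward
  \<pi>-orbit of x as its support, since it never leaves its support. So both cycles move the same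
  points, and there both equal \<pi>.\<close>

lemma cycles_eqI:
  assumes "\<sigma> \<in> cycles n" "\<tau> \<in> cycles n"
    and "\<And>y. \<sigma> y \<noteq> y \<Longrightarrow> \<sigma> y = \<pi> y" "\<And>y. \<tau> y \<noteq> y \<Longrightarrow> \<tau> y = \<pi> y"
    and "\<sigma> x \<noteq> x" "\<tau> x \<noteq> x"
  shows "\<sigma> = \<tau>"
proof -
  have supp: "{y. c y \<noteq> y} = {y. \<exists>k. y = (\<pi> ^^ k) x}"
    if c: "c \<in> cycles n" "\<And>y. c y \<noteq> y \<Longrightarrow> c y = \<pi> y" "c x \<noteq> x" for c
  proof -
    obtain cs where cs: "distinct cs" "c = cycle_of_list cs" "{x. c x \<noteq> x} = set cs"
      using c(1) by (elim cyclesE)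
    have inj: "inj c" using cycles_permutes[OF c(1)] by (rule permutes_inj)
    have pow: "(c ^^ k) x = (\<pi> ^^ k) x \<and> c ((c ^^ k) x) \<noteq> (c ^^ k) x" for k
    proof (induction k)
      case (Suc k)
      have "c ((c ^^ k) x) = \<pi> ((c ^^ k) x)" using Suc c(2) by blast
      then have "(c ^^ Suc k) x = (\<pi> ^^ Suc k) x" using Suc by simp
      moreover have "c (c ((c ^^ k) x)) \<noteq> c ((c ^^ k) x)" using Suc injD[OF inj] by blast
      ultimately show ?case by simp
    qed (use c(3) in simp)
    have x: "x \<in> set cs" using c(3) cs(3) by blast
    show ?thesis
    proof (intro equalityI subsetI)
      fix y assume "y \<in> {y. c y \<noteq> y}"
      then have "y \<in> set cs" using cs(3) by blast
      then obtain k where "y = (c ^^ k) x"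
        using cycle_of_list_reaches[OF cs(1) x] cs(2) by blast
      then show "y \<in> {y. \<exists>k. y = (\<pi> ^^ k) x}" using pow by auto
    next
      fix y assume "y \<in> {y. \<exists>k. y = (\<pi> ^^ k) x}"
      then obtain k where "y = (c ^^ k) x" using pow by auto
      then show "y \<in> {y. c y \<noteq> y}" using pow by blast
    qed
  qed
  have eq: "{y. \<sigma> y \<noteq> y} = {y. \<tau> y \<noteq> y}"
    using supp[OF assms(1,3,5)] supp[OF assms(2,4,6)] by simp
  show ?thesis
  proof
    fix y show "\<sigma> y = \<tau> y"
    proof (cases "\<sigma> y = y")
      case True
      then show ?thesis using eq by (metis (mono_tags) mem_Collect_eq)
    next
      case False
      then have "\<tau> y \<noteq> y" using eq by blast
      with False show ?thesis using assms(3,4) by metis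
    qed
  qed
qed

section \<open>Products of pairwise disjoint cycles\<close>

lemma word_prod_fixes: "(\<And>\<sigma>. \<sigma> \<in> set f \<Longrightarrow> \<sigma> x = x) \<Longrightarrow> word_prod f x = x"
  by (induction f) (simp_all only: word_prod_simps id_apply comp_apply list.set_intros)

text \<open>The letters to the right of \<sigma> fix x, and those to its left fix \<sigma> x,
  because \<sigma> moves that point as well.\<close>

lemma word_prod_disjoint_apply:
  assumes "distinct f" "set f \<subseteq> cycles n" "pairwise disjoint_perms (set f)" "\<sigma> \<in> set f" "\<sigma> x \<noteq> x"
  shows "word_prod f x = \<sigma> x"
  using assms
proof (induction f)
  case (Cons \<tau> f)
  have disj: "\<rho> y = y" if "\<rho> \<in> set (\<tau> # f)" "\<rho> \<noteq> \<sigma>" "\<sigma> y \<noteq> y" for \<rho> y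
  proof -
    have "disjoint_perms \<rho> \<sigma>" using Cons.prems(3,4) that(1,2) unfolding pairwise_def by blast
    then show ?thesis using that(3) by (auto simp: disjoint_perms_def)
  qed
  show ?case
  proof (cases "\<sigma> = \<tau>")
    case True
    have "word_prod f x = x"
    proof (rule word_prod_fixes)
      fix \<rho> assume "\<rho> \<in> set f"
      then show "\<rho> x = x" using disj[of \<rho> x] Cons.prems(1,5) True by auto
    qed
    then show ?thesis using True by simp
  next
    case False
    have "word_prod f x = \<sigma> x"
      using Cons.prems False by (intro Cons.IH) (auto simp: pairwise_insert)
    moreover have "\<sigma> (\<sigma> x) \<noteq> \<sigma> x"
      using Cons.prems(2,4,5) cycles_permutes permutes_inj by (metis injD subsetD)
    ultimately show ?thesis using disj[of \<tau> "\<sigma> x"] False by simp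
  qed
qed simp

text \<open>A cycle is by definition a product of transpositions, each attaching one new point. They
  are split off one by one in the presence of \<open>q\<close>, and collected again into the cycle
  without it.\<close>

lemma cycle_of_list_stat:
  assumes "distinct cs" "set cs \<subseteq> {1..n}" "q permutes {1..n}" "\<And>x. x \<in> set cs \<Longrightarrow> q x = x"
  shows "factor_stat n [cycle_of_list cs \<circ> q] = factor_stat n [cycle_of_list cs, q]"
  using assms
proof (induction cs rule: cycle_of_list.induct)
  case (1 i j cs)
  \<comment> \<open>The transposition is written with i second because i is the attached point: it
    is fixed by the shorter cycle and by \<open>q\<close>.\<close>
  let ?c = "cycle_of_list (j # cs)" and ?t = "transpose j i"
  have perm: "?c permutes {1..n}"
    using "1.prems"(2) by (intro permutes_subset[OF cycle_permutes]) auto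
  have fix_i: "?c i = i" using "1.prems"(1) by (intro id_outside_supp) auto
  have "cycle_of_list (i # j # cs) \<circ> q = ?t \<circ> (?c \<circ> q)"
    by (simp add: comp_assoc transpose_commute)
  then have "factor_stat n [cycle_of_list (i # j # cs) \<circ> q] = factor_stat n [?t \<circ> (?c \<circ> q)]"
    by (simp only:)
  also have "factor_stat n [?t \<circ> (?c \<circ> q)] = factor_stat n [?t, ?c \<circ> q]"
    using 1 fix_i perm by (intro transpose_stat permutes_compose) auto
  also have "\<dots> = factor_stat n [?t, ?c, q]"
    using 1 by (intro factor_stat_Cons_cong "1.IH") auto
  also have "\<dots> = factor_stat n ([?t, ?c] @ [q])" by simp
  also have "\<dots> = factor_stat n ([?t \<circ> ?c] @ [q])"
    using 1 fix_i perm by (intro factor_stat_append_cong transpose_stat[symmetric] refl) auto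
  finally show ?case unfolding cycle_of_list.simps transpose_commute[of i j] append.simps .
qed (simp_all add: factor_stat_id_Cons)

lemma factor_stat_disjoint_cycles:
  assumes "distinct f" "set f \<subseteq> cycles n" "pairwise disjoint_perms (set f)"
  shows "factor_stat n [word_prod f] = factor_stat n f"
  using assms
proof (induction f)
  case Nil
  show ?case
    using factor_stat_id_Cons[of n "[]"] by (simp only: word_prod_simps)
next
  case (Cons \<sigma> f)
  have f: "distinct f" "set f \<subseteq> cycles n" "pairwise disjoint_perms (set f)"
    using Cons.prems by (auto simp: pairwise_insert)
  have "\<sigma> \<in> cycles n" using Cons.prems(2) by simp
  then obtain cs where cs: "distinct cs" "set cs \<subseteq> {1..n}" "\<sigma> = cycle_of_list cs" "{x. \<sigma> x \<noteq> x} = set cs"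
    by (elim cyclesE)
  have "word_prod f x = x" if "x \<in> set cs" for x
  proof (rule word_prod_fixes)
    fix \<tau> assume "\<tau> \<in> set f"
    then have "\<tau> \<noteq> \<sigma>" "\<tau> \<in> set (\<sigma> # f)" using Cons.prems(1) by auto
    then have "disjoint_perms \<tau> \<sigma>" using Cons.prems(3) unfolding pairwise_def by simp
    then show "\<tau> x = x" using that cs(4) by (auto simp: disjoint_perms_def)
  qed
  moreover have "word_prod f permutes {1..n}"
    using f(2) cycles_permutes by (intro word_prod_permutes) blast
  ultimately have "factor_stat n [\<sigma> \<circ> word_prod f] = factor_stat n [\<sigma>, word_prod f]"
    using cs by (simp only: cycle_of_list_stat)
  also have "\<dots> = factor_stat n (\<sigma> # f)"
    by (rule factor_stat_Cons_cong[OF Cons.IH[OF f]])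
  finally show ?case by (simp only: word_prod_simps)
qed

definition list_of_set :: "'a set \<Rightarrow> 'a list" where
  "list_of_set S = (SOME f. distinct f \<and> set f = S)"

lemma list_of_set:
  assumes "finite S"
  shows "distinct (list_of_set S)" "set (list_of_set S) = S"
  using someI_ex[of "\<lambda>f. distinct f \<and> set f = S"] finite_distinct_list[OF assms]
  unfolding list_of_set_def by blast+

lemma list_of_clique:
  assumes "S \<in> cliques n"
  shows "distinct (list_of_set S)" "set (list_of_set S) = S" "set (list_of_set S) \<subseteq> cycles n"
    "pairwise disjoint_perms (set (list_of_set S))"
proof -
  have S: "S \<subseteq> cycles n" "pairwise disjoint_perms S" using assms by (auto simp: cliques_def)
  then have "finite S" using finite_cycles finite_subset by blast
  from list_of_set[OF this] S show "distinct (list_of_set S)" "set (list_of_set S) = S"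
    "set (list_of_set S) \<subseteq> cycles n" "pairwise disjoint_perms (set (list_of_set S))" by simp_all
qed

text \<open>Uniqueness of the decomposition into disjoint cycles: the right-hand side depends on S
  only through the product. A cycle agreeing with the product shares a moved point with some letter
  of S and equals it by \<open>cycles_eqI\<close>.\<close>

lemma clique_eq_cycles_of_prod:
  assumes "S \<in> cliques n"
  shows "S = {\<sigma> \<in> cycles n. \<forall>x. \<sigma> x \<noteq> x \<longrightarrow> \<sigma> x = word_prod (list_of_set S) x}"
proof (intro equalityI subsetI)
  fix \<sigma> assume "\<sigma> \<in> S"
  then show "\<sigma> \<in> {\<sigma> \<in> cycles n. \<forall>x. \<sigma> x \<noteq> x \<longrightarrow> \<sigma> x = word_prod (list_of_set S) x}"
    using word_prod_disjoint_apply[OF list_of_clique(1,3,4)[OF assms]] list_of_clique(2)[OF assms]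
      assms unfolding cliques_def by auto
next
  fix \<sigma> assume "\<sigma> \<in> {\<sigma> \<in> cycles n. \<forall>x. \<sigma> x \<noteq> x \<longrightarrow> \<sigma> x = word_prod (list_of_set S) x}"
  then have \<sigma>: "\<sigma> \<in> cycles n" "\<And>x. \<sigma> x \<noteq> x \<Longrightarrow> \<sigma> x = word_prod (list_of_set S) x" by auto
  obtain x where x: "\<sigma> x \<noteq> x" using cycles_not_id[OF \<sigma>(1)] by (auto simp: fun_eq_iff)
  then have "word_prod (list_of_set S) x \<noteq> x" using \<sigma>(2)[of x] by simp
  then obtain \<tau> where \<tau>: "\<tau> \<in> set (list_of_set S)" "\<tau> x \<noteq> x" using word_prod_fixes by metis
  have "\<sigma> = \<tau>"
  proof (rule cycles_eqI[where \<pi> = "word_prod (list_of_set S)" and x = x])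
    show "\<tau> \<in> cycles n" using \<tau>(1) list_of_clique(3)[OF assms] by blast
    show "\<tau> y = word_prod (list_of_set S) y" if "\<tau> y \<noteq> y" for y
      using word_prod_disjoint_apply[OF list_of_clique(1,3,4)[OF assms] \<tau>(1) that] by simp
  qed (use \<sigma> x \<tau>(2) in \<open>blast+\<close>)
  then show "\<sigma> \<in> S" using \<tau>(1) list_of_clique(2)[OF assms] by simp
qed

text \<open>Existence of the decomposition. \<open>cycle_decomp\<close> admits lists of length below
  2; these denote the identity and are dropped. The condition on supports keeps the next cycle
  disjoint from the earlier ones.\<close>

lemma cycle_decomp_imp_clique_word:
  assumes "cycle_decomp I p" "I \<subseteq> {1..n}"
  shows "\<exists>f. distinct f \<and> set f \<in> cliques n \<and> word_prod f = p \<and> (\<forall>\<sigma>\<in>set f. {x. \<sigma> x \<noteq> x} \<subseteq> I)"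
  using assms
proof (induction rule: cycle_decomp.induct)
  case empty
  show ?case by (rule exI[of _ "[]"]) (simp add: cliques_def)
next
  case (comp I p cs)
  then obtain f where f: "distinct f" "set f \<in> cliques n" "word_prod f = p"
    "\<forall>\<sigma>\<in>set f. {x. \<sigma> x \<noteq> x} \<subseteq> I" by auto
  show ?case
  proof (cases "2 \<le> length cs")
    case False
    then have "cycle_of_list cs = id" by (cases cs rule: cycle_of_list.cases) auto
    then show ?thesis using f by (intro exI[of _ f]) auto
  next
    case True
    let ?c = "cycle_of_list cs"
    have c: "?c \<in> cycles n"
      using True comp.hyps(2) comp.prems by (auto simp: cycles_def nontrivial_cycle_def)
    have supp: "{x. ?c x \<noteq> x} \<subseteq> set cs" using id_outside_supp by fastforce
    have disj: "disjoint_perms ?c \<sigma>" if "\<sigma> \<in> set f" for \<sigma>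
      using that f(4) supp comp.hyps(3) unfolding disjoint_perms_def by blast
    have "?c \<notin> set f"
      using disj[of ?c] cycles_not_id[OF c] disjoint_perms_self_iff by blast
    moreover have "set (?c # f) \<in> cliques n"
      using f(2) c disj disjoint_perms_commute unfolding cliques_def by (auto simp: pairwise_insert)
    moreover have "word_prod (?c # f) = ?c \<circ> p" using f(3) by (simp only: word_prod_simps)
    moreover have "\<forall>\<sigma>\<in>set (?c # f). {x. \<sigma> x \<noteq> x} \<subseteq> set cs \<union> I"
      using f(4) supp by auto
    ultimately show ?thesis using f(1) by (intro exI[of _ "?c # f"]) (simp only: distinct.simps simp_thms)
  qed
qed

lemma word_prod_clique_cong:
  assumes "distinct f" "distinct g" "set f = set g" "set f \<in> cliques n"
  shows "word_prod f = word_prod g"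
proof
  fix x
  have S: "set f \<subseteq> cycles n" "pairwise disjoint_perms (set f)" using assms(4) by (auto simp: cliques_def)
  show "word_prod f x = word_prod g x"
  proof (cases "\<exists>\<sigma>\<in>set f. \<sigma> x \<noteq> x")
    case True
    then obtain \<sigma> where \<sigma>: "\<sigma> \<in> set f" "\<sigma> x \<noteq> x" by blast
    show ?thesis
      using word_prod_disjoint_apply[OF assms(1) S \<sigma>]
        word_prod_disjoint_apply[OF assms(2) S[unfolded assms(3)] \<sigma>[unfolded assms(3)]] by simp
  next
    case False
    then show ?thesis using word_prod_fixes[of f x] word_prod_fixes[of g x] assms(3) by simp
  qed
qed

lemma bij_betw_cliques:
  "bij_betw (\<lambda>S. word_prod (list_of_set S)) (cliques n) {\<sigma>. \<sigma> permutes {1..n}}"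
proof (rule bij_betwI')
  fix S T assume ST: "S \<in> cliques n" "T \<in> cliques n"
  show "word_prod (list_of_set S) = word_prod (list_of_set T) \<longleftrightarrow> S = T"
    using clique_eq_cycles_of_prod[OF ST(1)] clique_eq_cycles_of_prod[OF ST(2)] by metis
next
  fix S assume S: "S \<in> cliques n"
  have "word_prod (list_of_set S) permutes {1..n}"
    using list_of_clique(3)[OF S] cycles_permutes by (intro word_prod_permutes) blast
  then show "word_prod (list_of_set S) \<in> {\<sigma>. \<sigma> permutes {1..n}}" by blast
next
  fix \<sigma> assume "\<sigma> \<in> {\<sigma>. \<sigma> permutes {1..n}}"
  then have "cycle_decomp {1..n} \<sigma>" by (intro cycle_decomposition) auto
  then obtain f where f: "distinct f" "set f \<in> cliques n" "word_prod f = \<sigma>"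
    using cycle_decomp_imp_clique_word by blast
  have "word_prod (list_of_set (set f)) = word_prod f"
    using list_of_clique(1,2)[OF f(2)] f by (intro word_prod_clique_cong) auto
  then show "\<exists>S\<in>cliques n. \<sigma> = word_prod (list_of_set S)"
    using f by (intro bexI[of _ "set f"]) simp_all
qed

subsection \<open>Inequivalent words\<close>

lemma disjoint_perms_comp_commute:
  assumes "inj \<sigma>" "inj \<tau>" "disjoint_perms \<sigma> \<tau>"
  shows "\<sigma> \<circ> \<tau> = \<tau> \<circ> \<sigma>"
proof
  fix x
  have *: "\<rho> (\<upsilon> x) = \<upsilon> x" if "inj \<upsilon>" "disjoint_perms \<upsilon> \<rho>" "\<upsilon> x \<noteq> x" for \<upsilon> \<rho> :: "'a \<Rightarrow> 'a"
  proof -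
    have "\<upsilon> (\<upsilon> x) \<noteq> \<upsilon> x" using that(1,3) by (metis injD)
    then show ?thesis using that(2) unfolding disjoint_perms_def by blast
  qed
  have fixed: "\<sigma> x = x \<or> \<tau> x = x" using assms(3) unfolding disjoint_perms_def by blast
  show "(\<sigma> \<circ> \<tau>) x = (\<tau> \<circ> \<sigma>) x"
  proof (cases "\<sigma> x = x")
    case True
    show ?thesis
    proof (cases "\<tau> x = x")
      case False
      then have "\<sigma> (\<tau> x) = \<tau> x" using * assms disjoint_perms_commute by metis
      then show ?thesis unfolding comp_apply True .
    next
      case \<tau>: True
      show ?thesis unfolding comp_apply True \<tau> ..
    qed
  next
    case False
    then have "\<tau> x = x" using fixed by blast
    moreover have "\<tau> (\<sigma> x) = \<sigma> x" using * assms False by metis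
    ultimately show ?thesis unfolding comp_apply by simp
  qed
qed

lemma swap_step_factor_stat:
  assumes "swap_step f g" "\<And>\<sigma>. \<sigma> \<in> set f \<Longrightarrow> \<sigma> permutes {1..n}"
  shows "factor_stat n f = factor_stat n g"
  using assms
proof (induction rule: swap_step.induct)
  case (1 \<sigma> \<tau> xs ys)
  have "inj \<sigma>" "inj \<tau>" using "1.prems"[of \<sigma>] "1.prems"[of \<tau>] permutes_inj by auto
  then have "word_prod [\<sigma>, \<tau>] = word_prod [\<tau>, \<sigma>]"
    using disjoint_perms_comp_commute 1(1) by (simp only: word_prod_simps comp_id)
  moreover have "depth n [\<sigma>, \<tau>] = depth n [\<tau>, \<sigma>]"
    using depth_append[of n "[\<sigma>]" "[\<tau>]"] depth_append[of n "[\<tau>]" "[\<sigma>]"] by simp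
  moreover have "invariant_sets n [\<sigma>, \<tau>] = invariant_sets n [\<tau>, \<sigma>]"
    unfolding invariant_sets_def by auto
  ultimately have "factor_stat n [\<sigma>, \<tau>] = factor_stat n [\<tau>, \<sigma>]"
    by (simp only: factor_stat_def)
  then show ?case by (intro factor_stat_append_cong refl)
qed

lemma swaps_factor_stat:
  assumes "f \<approx> g" "\<And>\<sigma>. \<sigma> \<in> set f \<Longrightarrow> \<sigma> permutes {1..n}"
  shows "factor_stat n f = factor_stat n g"
  using assms
proof (induction rule: rtranclp_induct)
  case (step g h)
  have "factor_stat n g = factor_stat n h"
    by (rule swap_step_factor_stat[OF step(2)]) (use step(4) swaps_set[OF step(1)] in blast)
  then show ?case using step by simp
qed simp

lemma normal_form_Nil [simp]: "normal_form [] = []"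
  by (metis length_0_conv length_normal_form)

definition normal_words :: "nat \<Rightarrow> (nat \<Rightarrow> nat) list set" where
  "normal_words n = {t. set t \<subseteq> cycles n \<and> normal_form t = t}"

lemma normal_form_in_normal_words: "set f \<subseteq> cycles n \<Longrightarrow> normal_form f \<in> normal_words n"
  by (simp add: normal_words_def)

lemma list_of_set_empty [simp]: "list_of_set {} = []"
  using list_of_set(2)[of "{}"] by simp

lemma swaps_list_of_clique_insert:
  assumes "insert \<sigma> S \<in> cliques n" "\<sigma> \<notin> S"
  shows "list_of_set S @ [\<sigma>] \<approx> list_of_set (insert \<sigma> S)"
proof -
  have "S \<in> cliques n" using assms(1) by (auto simp: cliques_def pairwise_insert)
  note l = list_of_clique[OF this] list_of_clique[OF assms(1)]
  show ?thesis
  proof (rule swaps_distinct_pairwise_disjoint)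
    show "distinct (list_of_set S @ [\<sigma>])" using l(1,2) assms(2) by simp
    show "set (list_of_set S @ [\<sigma>]) = set (list_of_set (insert \<sigma> S))" using l(2,6) by simp
    then show "id \<notin> set (list_of_set S @ [\<sigma>])" "pairwise disjoint_perms (set (list_of_set S @ [\<sigma>]))"
      using l(7,8) cycles_not_id by auto
  qed (rule l(5))
qed

text \<open>
  Cartier and Foata's involution moves one canonically chosen possible first letter of the
  product between the clique and the word.
\<close>

definition clique_toggle ::
  "(nat \<Rightarrow> nat) set \<times> (nat \<Rightarrow> nat) list \<Rightarrow> (nat \<Rightarrow> nat) set \<times> (nat \<Rightarrow> nat) list" where
  "clique_toggle = (\<lambda>(S, t). let c = hd (normal_form (list_of_set S @ t)) in
     if c \<in> S then (S - {c}, normal_form (c # t)) else (insert c S, normal_form (remove1 c t)))"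

text \<open>The letter c is read off the commutation class of the whole product, and toggling keeps
  that class. So a second application selects the same c and undoes the first.\<close>

lemma clique_toggle:
  assumes "S \<in> cliques n" "t \<in> normal_words n" "(S, t) \<noteq> ({}, [])"
    and "clique_toggle (S, t) = (S', t')"
  shows "S' \<in> cliques n" "t' \<in> normal_words n" "(S', t') \<noteq> ({}, [])"
    and "list_of_set S' @ t' \<approx> list_of_set S @ t"
    and "clique_toggle (S', t') = (S, t)"
    and "length t' = Suc (length t) \<or> length t = Suc (length t')"
proof -
  define w where "w = list_of_set S @ t"
  define c where "c = hd (normal_form w)"
  note lS = list_of_clique[OF assms(1)]
  have t: "set t \<subseteq> cycles n" "normal_form t = t" using assms(2) by (auto simp: normal_words_def)
  have w_cycles: "set w \<subseteq> cycles n" using lS t by (auto simp: w_def)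
  have no_id: "id \<notin> set w" using w_cycles cycles_not_id by blast
  have "w \<noteq> []" using assms(3) lS(2) by (auto simp: w_def)
  then have "normal_form w \<noteq> []" by (metis length_0_conv length_normal_form)
  then have nf: "normal_form w = c # tl (normal_form w)" by (simp add: c_def)
  have cu: "c # tl (normal_form w) \<approx> w" using swaps_sym[OF swaps_normal_form] nf by metis
  have c_cyc: "c \<in> cycles n" using nf w_cycles by (metis list.set_intros(1) set_normal_form subsetD)
  have toggle: "clique_toggle (S, t) =
      (if c \<in> S then (S - {c}, normal_form (c # t)) else (insert c S, normal_form (remove1 c t)))"
    by (simp only: clique_toggle_def prod.case Let_def c_def w_def)
  have *: "S' \<in> cliques n \<and> t' \<in> normal_words n \<and> (S', t') \<noteq> ({}, []) \<and>
    list_of_set S' @ t' \<approx> w \<and>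
    (if c \<in> S' then (S' - {c}, normal_form (c # t')) else (insert c S', normal_form (remove1 c t'))) = (S, t) \<and>
    (length t' = Suc (length t) \<or> length t = Suc (length t'))"
  proof (cases "c \<in> S")
    case True
    then have S': "S' = S - {c}" "t' = normal_form (c # t)" using toggle assms(4) by simp_all
    have ins: "insert c S' = S" "c \<notin> S'" using True S' by auto
    have "S' \<in> cliques n"
      using assms(1) S'(1) unfolding cliques_def by (auto intro: pairwise_subset)
    moreover have "t' \<in> normal_words n"
      unfolding S'(2) using c_cyc t by (intro normal_form_in_normal_words) simp
    moreover have len: "length t' = Suc (length t)" using S'(2) by simp
    then have "t' \<noteq> []" by auto
    moreover have "list_of_set S' @ t' \<approx> w"
    proof -
      have "list_of_set S' @ t' \<approx> list_of_set S' @ (c # t)"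
        unfolding S'(2) by (rule swaps_append[OF _ swaps_sym[OF swaps_normal_form]]) simp
      also have "list_of_set S' @ (c # t) = (list_of_set S' @ [c]) @ t" by simp
      also have "\<dots> \<approx> list_of_set S @ t"
        using swaps_list_of_clique_insert[of c S' n] ins assms(1)
        by (intro swaps_append) simp_all
      finally show ?thesis by (simp only: w_def)
    qed
    moreover have "normal_form (remove1 c t') = t"
    proof -
      have "id \<notin> set t'" using S'(2) c_cyc t(1) cycles_not_id by auto
      then have "t \<approx> remove1 c t'"
        using swaps_normal_form[of "c # t"] unfolding S'(2)[symmetric] by (rule swaps_Cons_imp_remove1[rotated])
      then show ?thesis using normal_form_cong t(2) by metis
    qed
    ultimately show ?thesis using ins len by simp
  next
    case False
    then have S': "S' = insert c S" "t' = normal_form (remove1 c t)" using toggle assms(4) by simp_all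
    have "c \<notin> set (list_of_set S)" using False lS(2) by simp
    \<comment> \<open>As c can come first in \<open>w\<close> without belonging to S, it is disjoint
      from all of S and is a possible first letter of \<open>t\<close>.\<close>
    note first = swaps_first_letter[OF cu[unfolded w_def] no_id[unfolded w_def] this]
    have "insert c S \<in> cliques n"
      using assms(1) c_cyc first(1) lS(2) disjoint_perms_commute unfolding cliques_def
      by (auto simp: pairwise_insert)
    then have S'_clique: "S' \<in> cliques n" using S'(1) by simp
    moreover have "t' \<in> normal_words n"
      unfolding S'(2) using t(1) set_remove1_subset by (intro normal_form_in_normal_words) fast
    moreover have len: "length t = Suc (length t')"
      using first(3) S'(2) by (simp add: length_remove1) (metis Suc_pred length_pos_if_in_set)
    moreover have "list_of_set S' @ t' \<approx> w"
    proof -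
      have "list_of_set S' @ t' \<approx> (list_of_set S @ [c]) @ remove1 c t"
        unfolding S'(2) S'(1)
        using swaps_sym[OF swaps_list_of_clique_insert[OF \<open>insert c S \<in> cliques n\<close> False]]
          swaps_sym[OF swaps_normal_form] by (rule swaps_append)
      also have "\<dots> = list_of_set S @ (c # remove1 c t)" by simp
      also have "\<dots> \<approx> list_of_set S @ t" by (rule swaps_append[OF _ first(2)]) simp
      finally show ?thesis by (simp only: w_def)
    qed
    moreover have "normal_form (c # t') = t"
    proof -
      have "c # t' \<approx> c # remove1 c t"
        unfolding S'(2) by (rule swaps_Cons[OF swaps_sym[OF swaps_normal_form]])
      then have "c # t' \<approx> t" using first(2) by simp
      then show ?thesis using normal_form_cong t(2) by metis
    qed
    moreover have "S' - {c} = S" "c \<in> S'" using S'(1) False by auto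
    ultimately show ?thesis by auto
  qed
  then show "S' \<in> cliques n" "t' \<in> normal_words n" "(S', t') \<noteq> ({}, [])"
    "list_of_set S' @ t' \<approx> list_of_set S @ t"
    "length t' = Suc (length t) \<or> length t = Suc (length t')"
    unfolding w_def by blast+
  have "normal_form (list_of_set S' @ t') = normal_form w"
    using * normal_form_cong by blast
  then have "hd (normal_form (list_of_set S' @ t')) = c" unfolding c_def by (rule arg_cong)
  then show "clique_toggle (S', t') = (S, t)"
    using * by (simp only: clique_toggle_def prod.case Let_def)
qed

lemma inverse_family_normal_words:
  "inverse_family n (normal_words n) (\<lambda>t. t) (\<lambda>t. (-1) ^ length t)"
proof (rule inverse_familyI[where vd = list_of_set and V = "cliques n" and \<phi> = clique_toggle
      and ?v0.0 = "{}" and ?k0.0 = "[]"])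
  fix d
  have "{t \<in> normal_words n. depth n t \<le> d} \<subseteq>
    {w. w \<in> lists ({\<sigma>. \<sigma> permutes {1..n}} - {id}) \<and> depth n w \<le> d}"
    using cycles_subset unfolding normal_words_def lists_eq_set by blast
  then show "finite {t \<in> normal_words n. depth n t \<le> d}"
    using finite_words_bounded_depth finite_subset by blast
next
  show "factor_stat n [word_prod (list_of_set S)] = factor_stat n (list_of_set S)" if "S \<in> cliques n" for S
    using factor_stat_disjoint_cycles[OF list_of_clique(1,3,4)[OF that]] .
next
  show "({}, []) \<in> cliques n \<times> normal_words n"
    by (simp add: cliques_def normal_words_def)
next
  fix z assume "z \<in> cliques n \<times> normal_words n - {({}, [])}"
  then obtain S t where z: "z = (S, t)" "S \<in> cliques n" "t \<in> normal_words n" "(S, t) \<noteq> ({}, [])"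
    by auto
  obtain S' t' where z': "clique_toggle (S, t) = (S', t')" by (cases "clique_toggle (S, t)")
  note toggle = clique_toggle[OF z(2,3,4) z']
  show "clique_toggle z \<in> cliques n \<times> normal_words n - {({}, [])}"
    using toggle(1,2,3) z(1) z' by simp
  show "clique_toggle (clique_toggle z) = z" unfolding z(1) z' by (rule toggle(5))
  show "(- 1) ^ length (snd (clique_toggle z)) = - ((- 1) ^ length (snd z) :: rat)"
    unfolding z(1) z' using toggle(6) by auto
  have "set (list_of_set S' @ t') \<subseteq> cycles n"
    using list_of_clique(3)[OF toggle(1)] toggle(2) by (auto simp: normal_words_def)
  then have "factor_stat n (list_of_set S' @ t') = factor_stat n (list_of_set S @ t)"
    using cycles_permutes by (intro swaps_factor_stat[OF toggle(4)]) blast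
  then show "factor_stat n (list_of_set (fst (clique_toggle z)) @ snd (clique_toggle z)) =
    factor_stat n (list_of_set (fst z) @ snd z)"
    unfolding z(1) z' fst_conv snd_conv .
qed (rule bij_betw_cliques, simp_all)

subsection \<open>Counting\<close>

text \<open>Invariance under the letters passes to the group they generate, so a transitive group
  leaves nothing between {} and {1..n}. Conversely, the orbit of a point under that group is a
  nonempty invariant set.\<close>

lemma transitive_fact_iff_invariant_sets:
  assumes "\<And>\<sigma>. \<sigma> \<in> set f \<Longrightarrow> \<sigma> permutes {1..n}"
  shows "transitive_fact n f \<longleftrightarrow> invariant_sets n f \<subseteq> {{}, {1..n}}"
proof -
  let ?G = "generate (sym_group n) (set f)"
  have inv_eq: "m_inv (sym_group n) \<sigma> = inv' \<sigma>" if "\<sigma> \<in> set f" for \<sigma>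
    using assms[OF that] by (simp add: sym_group_carrier)
  have perm: "h permutes {1..n}" if "h \<in> ?G" for h
    using that
  proof (induction rule: generate.induct)
    case one
    show ?case by (simp only: sym_group_one permutes_id)
  next
    case (inv h)
    then show ?case using inv_eq assms permutes_inv by metis
  next
    case (eng h1 h2)
    then show ?case by (simp only: sym_group_mult permutes_compose)
  qed (rule assms)
  show ?thesis
  proof
    assume trans: "transitive_fact n f"
    show "invariant_sets n f \<subseteq> {{}, {1..n}}"
    proof
      fix X assume X: "X \<in> invariant_sets n f"
      have inv: "h y \<in> X \<longleftrightarrow> y \<in> X" if "h \<in> ?G" for h y
        using that
      proof (induction arbitrary: y rule: generate.induct)
        case one
        show ?case by (simp only: sym_group_one id_apply)
      next
        case (incl h)
        then show ?case using X by (simp add: invariant_sets_def)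
      next
        case (inv h)
        have "h (inv' h y) = y" using assms[OF inv] by (rule permutes_inverses(1))
        moreover have "h (inv' h y) \<in> X \<longleftrightarrow> inv' h y \<in> X"
          using X inv by (simp add: invariant_sets_def)
        ultimately show ?case unfolding inv_eq[OF inv] by simp
      next
        case (eng h1 h2)
        then show ?case by (simp only: sym_group_mult comp_apply)
      qed
      show "X \<in> {{}, {1..n}}"
      proof (cases "X = {}")
        case False
        then obtain x where x: "x \<in> X" by blast
        have sub: "X \<subseteq> {1..n}" using X by (simp add: invariant_sets_def)
        have "{1..n} \<subseteq> X"
        proof
          fix y assume "y \<in> {1..n}"
          then obtain h where "h \<in> ?G" "h x = y"
            using trans x sub unfolding transitive_fact_def by blast
          then show "y \<in> X" using inv x by blast
        qed
        with sub show ?thesis by blast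
      qed simp
    qed
  next
    assume triv: "invariant_sets n f \<subseteq> {{}, {1..n}}"
    show "transitive_fact n f"
      unfolding transitive_fact_def
    proof (intro ballI)
      fix x y assume x: "x \<in> {1..n}" and y: "y \<in> {1..n}"
      define X where "X = (\<lambda>h. h x) ` ?G"
      have mult: "(\<sigma> \<circ> h) \<in> ?G" if "\<sigma> \<in> ?G" "h \<in> ?G" for \<sigma> h
        using generate.eng[OF that] by (simp only: sym_group_mult)
      have "X \<subseteq> {1..n}" unfolding X_def using perm x by (blast dest: permutes_in_image)
      moreover have "\<sigma> z \<in> X \<longleftrightarrow> z \<in> X" if \<sigma>: "\<sigma> \<in> set f" for \<sigma> z
      proof
        assume "z \<in> X"
        then obtain h where "h \<in> ?G" "z = h x" by (auto simp: X_def)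
        then have "\<sigma> \<circ> h \<in> ?G" "\<sigma> z = (\<sigma> \<circ> h) x" using mult generate.incl[OF \<sigma>] by auto
        then show "\<sigma> z \<in> X" unfolding X_def by blast
      next
        assume "\<sigma> z \<in> X"
        then obtain h where h: "h \<in> ?G" "\<sigma> z = h x" by (auto simp: X_def)
        have "inv' \<sigma> \<in> ?G" using generate.inv[OF \<sigma>, of "sym_group n"] inv_eq[OF \<sigma>] by simp
        then have "inv' \<sigma> \<circ> h \<in> ?G" using mult h(1) by blast
        moreover have "z = (inv' \<sigma> \<circ> h) x"
          using permutes_inverses(2)[OF assms[OF \<sigma>], of z] h(2) by simp
        ultimately show "z \<in> X" unfolding X_def by blast
      qed
      ultimately have "X \<in> invariant_sets n f" unfolding invariant_sets_def by blast
      moreover have "x \<in> X"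
        unfolding X_def using generate.one[of "sym_group n" "set f"] unfolding sym_group_one
        by (rule rev_image_eqI) simp
      ultimately have "X = {1..n}" using triv by blast
      then have "y \<in> X" using y by simp
      then show "\<exists>h\<in>?G. h x = y" unfolding X_def by blast
    qed
  qed
qed

text \<open>Finitely many statistics, so that a signed count at fixed product and genus is a finite
  sum of coefficients. The depth equation is stated over the integers because of the term
  -2.\<close>

definition genus_stats :: "nat \<Rightarrow> (nat \<Rightarrow> nat) \<Rightarrow> nat \<Rightarrow> ((nat \<Rightarrow> nat) \<times> nat set set \<times> nat) set" where
  "genus_stats n \<pi> g = {(p, I, d). p = \<pi> \<and> I \<subseteq> {{}, {1..n}} \<and>
     int d = int n + int (card (perm_cycles n \<pi>)) - 2 + 2 * int g}"

lemma finite_genus_stats: "finite (genus_stats n \<pi> g)"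
proof (rule finite_subset)
  show "genus_stats n \<pi> g \<subseteq> {\<pi>} \<times> Pow {{}, {1..n}} \<times>
      {nat (int n + int (card (perm_cycles n \<pi>)) - 2 + 2 * int g)}"
    by (auto simp: genus_stats_def)
qed simp

lemma genus_factorization_iff:
  "genus_factorization n \<pi> g f \<longleftrightarrow>
     (\<forall>\<sigma>\<in>set f. \<sigma> permutes {1..n}) \<and> factor_stat n f \<in> genus_stats n \<pi> g"
  using transitive_fact_iff_invariant_sets[of f n]
  unfolding genus_factorization_def factorization_def factor_stat_def genus_stats_def word_prod_def[symmetric]
  by blast

definition genus_words ::
  "nat \<Rightarrow> (nat \<Rightarrow> nat) \<Rightarrow> nat \<Rightarrow> 'k set \<Rightarrow> ('k \<Rightarrow> (nat \<Rightarrow> nat) list) \<Rightarrow> 'k set" where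
  "genus_words n \<pi> g K wd = {k \<in> K. factor_stat n (wd k) \<in> genus_stats n \<pi> g}"

lemma inverse_family_finite_genus_words:
  assumes "inverse_family n K wd sg"
  shows "finite (genus_words n \<pi> g K wd)"
proof -
  have fin: "finite {k\<in>K. factor_stat n (wd k) = t}" for t
  proof (rule finite_subset)
    show "{k\<in>K. factor_stat n (wd k) = t} \<subseteq> {k\<in>K. depth n (wd k) \<le> snd (snd t)}"
      by (auto simp: factor_stat_def)
    show "finite {k\<in>K. depth n (wd k) \<le> snd (snd t)}"
      using assms unfolding inverse_family_def by blast
  qed
  have eq: "genus_words n \<pi> g K wd = (\<Union>t\<in>genus_stats n \<pi> g. {k\<in>K. factor_stat n (wd k) = t})"
    by (auto simp: genus_words_def)
  show ?thesis unfolding eq by (rule finite_UN_I[OF finite_genus_stats fin])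
qed

lemma sum_genus_words_by_stat:
  assumes "inverse_family n K wd sg"
  shows "sum sg (genus_words n \<pi> g K wd) =
    (\<Sum>t\<in>genus_stats n \<pi> g. \<Sum>k | k \<in> K \<and> factor_stat n (wd k) = t. sg k)"
proof -
  have "sum sg (genus_words n \<pi> g K wd) = (\<Sum>t\<in>genus_stats n \<pi> g.
      sum sg {k \<in> genus_words n \<pi> g K wd. factor_stat n (wd k) = t})"
    by (rule sum.group[symmetric, OF inverse_family_finite_genus_words[OF assms] finite_genus_stats])
      (auto simp: genus_words_def)
  also have "\<dots> = (\<Sum>t\<in>genus_stats n \<pi> g. \<Sum>k | k \<in> K \<and> factor_stat n (wd k) = t. sg k)"
    by (intro sum.cong refl) (auto simp: genus_words_def)
  finally show ?thesis .
qed

lemma inverse_family_sum_genus_words: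
  assumes "inverse_family n K wd sg" "inverse_family n K' wd' sg'"
  shows "sum sg (genus_words n \<pi> g K wd) = sum sg' (genus_words n \<pi> g K' wd')"
  unfolding sum_genus_words_by_stat[OF assms(1)] sum_genus_words_by_stat[OF assms(2)]
  by (intro sum.cong refl inverse_family_unique[OF assms])

section \<open>From sums over words to sums over lengths\<close>

lemma sum_by_length:
  fixes h :: "nat \<Rightarrow> rat"
  assumes "finite A"
  shows "(\<Sum>f\<in>A. h (length f)) = (\<Sum>k\<in>length ` A. of_nat (card {f \<in> A. length f = k}) * h k)"
proof -
  have "(\<Sum>f\<in>A. h (length f)) = (\<Sum>k\<in>length ` A. \<Sum>f | f \<in> A \<and> length f = k. h (length f))"
    using sum.group[OF assms finite_imageI[OF assms], of length length "\<lambda>f. h (length f)"] by simp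
  also have "\<dots> = (\<Sum>k\<in>length ` A. of_nat (card {f \<in> A. length f = k}) * h k)"
    by (rule sum.cong) simp_all
  finally show ?thesis .
qed

lemma card_by_length_support:
  assumes "finite A"
  shows "{k. card {f \<in> A. length f = k} \<noteq> 0} \<subseteq> length ` A"
  using assms by (auto simp: card_eq_0_iff)

text \<open>The support lies in the finite set of lengths that occur in \<open>A\<close>, so the
  convention for infinite supports never intervenes.\<close>

lemma Sum_any_by_length:
  fixes h :: "nat \<Rightarrow> rat"
  assumes "finite A"
  shows "Sum_any (\<lambda>k. h k * of_nat (card {f \<in> A. length f = k})) = (\<Sum>f\<in>A. h (length f))"
proof -
  have "Sum_any (\<lambda>k. h k * of_nat (card {f \<in> A. length f = k})) =
      (\<Sum>k\<in>length ` A. h k * of_nat (card {f \<in> A. length f = k}))"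
  proof (rule Sum_any.expand_superset)
    show "{k. h k * of_nat (card {f \<in> A. length f = k}) \<noteq> 0} \<subseteq> length ` A"
      using card_by_length_support[OF assms] by auto
  qed (use assms in simp)
  also have "\<dots> = (\<Sum>f\<in>A. h (length f))"
    unfolding sum_by_length[OF assms] by (simp add: mult.commute)
  finally show ?thesis .
qed

text \<open>A word f is determined by the positions that the letters of p occupy in it. Splitting by
  the first letter gives Pascal's rule.\<close>

lemma card_insert_neutral_letters:
  assumes "e \<notin> set p"
  shows "finite {f. length f = r \<and> filter (\<lambda>x. x \<noteq> e) f = p} \<and>
    card {f. length f = r \<and> filter (\<lambda>x. x \<noteq> e) f = p} = r choose length p"
  using assms
proof (induction r arbitrary: p)
  case 0
  have "{f. length f = 0 \<and> filter (\<lambda>x. x \<noteq> e) f = p} = (if p = [] then {[]} else {})" by auto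
  then show ?case by (cases p) simp_all
next
  case (Suc r)
  let ?F = "\<lambda>r p. {f. length f = r \<and> filter (\<lambda>x. x \<noteq> e) f = p}"
  show ?case
  proof (cases p)
    case Nil
    have "?F (Suc r) p = (#) e ` ?F r p"
      unfolding Nil by (auto simp: length_Suc_conv image_iff split: if_splits)
    then show ?thesis using Suc.IH[OF Suc.prems] Nil by (simp add: card_image)
  next
    case (Cons a q)
    have ae: "a \<noteq> e" "e \<notin> set q" using Suc.prems Cons by auto
    have eq: "?F (Suc r) p = (#) e ` ?F r p \<union> (#) a ` ?F r q"
    proof (intro equalityI subsetI)
      fix f assume "f \<in> ?F (Suc r) p"
      then obtain b f' where "f = b # f'" "length f' = r" "filter (\<lambda>x. x \<noteq> e) (b # f') = a # q"
        using Cons by (auto simp: length_Suc_conv)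
      then show "f \<in> (#) e ` ?F r p \<union> (#) a ` ?F r q"
        using Cons by (cases "b = e") auto
    qed (use Cons ae in auto)
    have "(#) e ` ?F r p \<inter> (#) a ` ?F r q = {}" using ae by auto
    then have "card (?F (Suc r) p) = (r choose length p) + (r choose length q)"
      unfolding eq using Suc.IH[OF Suc.prems] Suc.IH[OF ae(2)]
      by (subst card_Un_disjoint) (simp_all add: card_image)
    moreover have "finite (?F (Suc r) p)"
      unfolding eq using Suc.IH[OF Suc.prems] Suc.IH[OF ae(2)] by simp
    ultimately show ?thesis using Cons by simp
  qed
qed

lemma factor_stat_filter_id: "factor_stat n (filter (\<lambda>\<sigma>. \<sigma> \<noteq> id) f) = factor_stat n f"
proof (induction f)
  case (Cons \<sigma> f)
  show ?case
  proof (cases "\<sigma> = id")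
    case True
    then show ?thesis using Cons.IH by (simp only: filter.simps factor_stat_id_Cons simp_thms if_False)
  next
    case False
    then have "filter (\<lambda>\<sigma>. \<sigma> \<noteq> id) (\<sigma> # f) = \<sigma> # filter (\<lambda>\<sigma>. \<sigma> \<noteq> id) f"
      by (simp only: filter.simps simp_thms if_True)
    then show ?thesis using factor_stat_Cons_cong[OF Cons.IH] by metis
  qed
qed (simp only: filter.simps)

abbreviation "proper_words n \<equiv> lists ({\<sigma>. \<sigma> permutes {1..n}} - {id})"

section \<open>The counting functions in terms of words of fixed genus\<close>

lemma num_proper_eq:
  "num_proper n \<pi> g r = card {f \<in> genus_words n \<pi> g (proper_words n) (\<lambda>w. w). length f = r}"
proof -
  have "{f. genus_factorization n \<pi> g f \<and> proper f \<and> length f = r} =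
      {f \<in> genus_words n \<pi> g (proper_words n) (\<lambda>w. w). length f = r}"
    unfolding genus_factorization_iff proper_def genus_words_def lists_eq_set by blast
  then show ?thesis by (simp only: num_proper_def)
qed

text \<open>Deleting the identity factors keeps the statistic and leaves a proper word p; the fibre
  over p is counted by the positions of its letters.\<close>

lemma num_fact_eq:
  "of_nat (num_fact n \<pi> g r) =
     (\<Sum>p\<in>genus_words n \<pi> g (proper_words n) (\<lambda>w. w). of_nat (r choose length p) :: rat)"
proof -
  let ?A = "genus_words n \<pi> g (proper_words n) (\<lambda>w. w)"
  let ?F = "\<lambda>p. {f. length f = r \<and> filter (\<lambda>\<sigma>. \<sigma> \<noteq> id) f = p}"
  have finA: "finite ?A" by (rule inverse_family_finite_genus_words[OF inverse_family_proper])
  have "p \<in> ?A \<longleftrightarrow> genus_factorization n \<pi> g f \<and> id \<notin> set p"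
    if "filter (\<lambda>\<sigma>. \<sigma> \<noteq> id) f = p" for f p
  proof -
    have "set p = set f - {id}" unfolding that[symmetric] set_filter by blast
    then have "(\<forall>\<sigma>\<in>set f. \<sigma> permutes {1..n}) \<longleftrightarrow> (\<forall>\<sigma>\<in>set p. \<sigma> permutes {1..n})" "id \<notin> set p"
      using permutes_id[of "{1..n}"] by blast+
    moreover have "factor_stat n f \<in> genus_stats n \<pi> g \<longleftrightarrow> factor_stat n p \<in> genus_stats n \<pi> g"
      using factor_stat_filter_id[of n f] unfolding that by (simp only:)
    ultimately show ?thesis
      unfolding genus_factorization_iff genus_words_def lists_eq_set mem_Collect_eq by blast
  qed
  moreover have "id \<notin> set (filter (\<lambda>\<sigma>. \<sigma> \<noteq> id) f)" for f :: "(nat \<Rightarrow> nat) list"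
    unfolding set_filter by blast
  ultimately have eq: "{f. genus_factorization n \<pi> g f \<and> length f = r} = (\<Union>p\<in>?A. ?F p)" by blast
  have F: "finite (?F p) \<and> card (?F p) = r choose length p" if "p \<in> ?A" for p
    by (rule card_insert_neutral_letters)
      (use that in \<open>unfold genus_words_def lists_eq_set, blast\<close>)
  have "num_fact n \<pi> g r = (\<Sum>p\<in>?A. card (?F p))"
    unfolding num_fact_def eq by (rule card_UN_disjoint) (use finA F in auto)
  also have "\<dots> = (\<Sum>p\<in>?A. r choose length p)" by (rule sum.cong) (use F in auto)
  finally show ?thesis by simp
qed

lemma poly_fact_poly:
  "poly (fact_poly n \<pi> g) x =
     (\<Sum>p\<in>genus_words n \<pi> g (proper_words n) (\<lambda>w. w). x gchoose length p)"
proof -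
  let ?A = "genus_words n \<pi> g (proper_words n) (\<lambda>w. w)"
  have finA: "finite ?A" by (rule inverse_family_finite_genus_words[OF inverse_family_proper])
  have "fact_poly n \<pi> g = (\<Sum>k\<in>length ` ?A. smult (of_nat (num_proper n \<pi> g k)) (binom_poly k))"
    unfolding fact_poly_def num_proper_eq
  proof (rule Sum_any.expand_superset)
    show "{k. smult (of_nat (card {f \<in> ?A. length f = k})) (binom_poly k) \<noteq> 0} \<subseteq> length ` ?A"
      using card_by_length_support[OF finA] by auto
  qed (use finA in simp)
  then have "poly (fact_poly n \<pi> g) x =
      (\<Sum>k\<in>length ` ?A. of_nat (card {f \<in> ?A. length f = k}) * (x gchoose k))"
    by (simp add: poly_sum poly_binom_poly num_proper_eq)
  then show ?thesis
    unfolding sum_by_length[OF finA, of "\<lambda>k. x gchoose k"] .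
qed

text \<open>Each class contains exactly one normal word, and it has the same product and genus
  because swaps preserve the statistic.\<close>

lemma num_inequivalent_eq:
  "num_inequivalent n \<pi> g r = card {f \<in> genus_words n \<pi> g (normal_words n) (\<lambda>w. w). length f = r}"
proof -
  let ?X = "{f. genus_factorization n \<pi> g f \<and> cycle_factors n f \<and> length f = r}"
  let ?N = "{f \<in> genus_words n \<pi> g (normal_words n) (\<lambda>w. w). length f = r}"
  have X: "f \<in> ?X \<longleftrightarrow> set f \<subseteq> cycles n \<and> factor_stat n f \<in> genus_stats n \<pi> g \<and> length f = r" for f
    using cycles_permutes unfolding genus_factorization_iff cycle_factors_def cycles_def by blast
  have N: "?N = {f \<in> ?X. normal_form f = f}"
    unfolding X genus_words_def normal_words_def by blast
  have closed: "normal_form f \<in> ?X" if "f \<in> ?X" for f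
  proof -
    have "factor_stat n f = factor_stat n (normal_form f)"
      by (rule swaps_factor_stat[OF swaps_normal_form]) (use that X cycles_permutes in blast)
    then show ?thesis using that unfolding X by simp
  qed
  have class_eq: "swap_equiv `` {f} = swap_equiv `` {f'} \<longleftrightarrow> f \<approx> f'" for f f' :: "(nat \<Rightarrow> nat) list"
  proof
    assume "swap_equiv `` {f} = swap_equiv `` {f'}"
    then have "f' \<in> swap_equiv `` {f}" by (simp add: swap_equiv_def)
    then show "f \<approx> f'" by (simp add: swap_equiv_def)
  next
    assume "f \<approx> f'"
    then show "swap_equiv `` {f} = swap_equiv `` {f'}"
      using swaps_sym[OF \<open>f \<approx> f'\<close>] by (auto simp: swap_equiv_def intro: rtranclp_trans)
  qed
  have "bij_betw (\<lambda>f. swap_equiv `` {f}) ?N (?X // swap_equiv)"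
  proof (rule bij_betwI')
    fix f f' assume "f \<in> ?N" "f' \<in> ?N"
    then have "normal_form f = f" "normal_form f' = f'" unfolding N by blast+
    then show "swap_equiv `` {f} = swap_equiv `` {f'} \<longleftrightarrow> f = f'"
      unfolding class_eq using normal_form_cong[of f f'] by (metis rtranclp.rtrancl_refl)
  next
    fix f assume "f \<in> ?N"
    then show "swap_equiv `` {f} \<in> ?X // swap_equiv" unfolding N by (blast intro: quotientI)
  next
    fix C assume "C \<in> ?X // swap_equiv"
    then obtain f where f: "f \<in> ?X" "C = swap_equiv `` {f}" by (rule quotientE)
    then have "C = swap_equiv `` {normal_form f}" using class_eq swaps_normal_form by blast
    moreover have "normal_form f \<in> ?N" unfolding N using closed[OF f(1)] by simp
    ultimately show "\<exists>f\<in>?N. C = swap_equiv `` {f}" by blast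
  qed
  then show ?thesis unfolding num_inequivalent_def by (rule bij_betw_same_card[symmetric])
qed

lemma num_monotone_eq: "num_monotone n \<pi> g = card (genus_words n \<pi> g (monotone_words n) tword)"
proof -
  have "{f. genus_factorization n \<pi> g f \<and> monotone_factors n f} =
      tword ` genus_words n \<pi> g (monotone_words n) tword"
  proof (intro equalityI subsetI)
    fix f assume f: "f \<in> {f. genus_factorization n \<pi> g f \<and> monotone_factors n f}"
    then obtain ts where ts: "f = tword ts" "ts \<in> monotone_words n"
      unfolding monotone_factors_def monotone_words_def tword_def tpairs_def lists_eq_set by blast
    then show "f \<in> tword ` genus_words n \<pi> g (monotone_words n) tword"
      using f unfolding genus_words_def genus_factorization_iff by blast
  next
    fix f assume "f \<in> tword ` genus_words n \<pi> g (monotone_words n) tword"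
    then obtain ts where ts: "f = tword ts" "ts \<in> monotone_words n"
      "factor_stat n (tword ts) \<in> genus_stats n \<pi> g" by (auto simp: genus_words_def)
    then have "monotone_factors n f"
      unfolding monotone_factors_def monotone_words_def tword_def tpairs_def by auto
    moreover have "genus_factorization n \<pi> g f"
      unfolding genus_factorization_iff using ts tword_permutes unfolding monotone_words_def by blast
    ultimately show "f \<in> {f. genus_factorization n \<pi> g f \<and> monotone_factors n f}" by blast
  qed
  moreover have "inj_on tword (genus_words n \<pi> g (monotone_words n) tword)"
    by (rule inj_on_subset[OF inj_on_tword]) (auto simp: genus_words_def monotone_words_def)
  ultimately show ?thesis by (simp add: num_monotone_def card_image)
qed

text \<open>A transposition has depth 1, so the length of a monotone word is its depth, which the
  genus fixes. All these words carry the same sign, and the terms -2 and 2g do not affect its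
  parity.\<close>

lemma sum_sign_monotone:
  "(\<Sum>ts\<in>genus_words n \<pi> g (monotone_words n) tword. (-1) ^ length ts) =
     (-1) ^ (n + card (perm_cycles n \<pi>)) * (of_nat (num_monotone n \<pi> g) :: rat)"
proof -
  have "(-1) ^ length ts = ((-1) ^ (n + card (perm_cycles n \<pi>)) :: rat)"
    if "ts \<in> genus_words n \<pi> g (monotone_words n) tword" for ts
  proof -
    have "ts \<in> lists (tpairs n)" "factor_stat n (tword ts) \<in> genus_stats n \<pi> g"
      using that by (auto simp: genus_words_def monotone_words_def)
    then have "int (length ts) = int n + int (card (perm_cycles n \<pi>)) - 2 + 2 * int g"
      using depth_tword[of ts n] by (simp add: factor_stat_def genus_stats_def)
    then have "length ts + 2 = n + card (perm_cycles n \<pi>) + 2 * g" by linarith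
    then have "even (length ts + 2) = even (n + card (perm_cycles n \<pi>) + 2 * g)" by (rule arg_cong)
    then have "even (length ts) = even (n + card (perm_cycles n \<pi>))" by simp
    then show ?thesis by (simp add: minus_one_power_iff)
  qed
  then have "(\<Sum>ts\<in>genus_words n \<pi> g (monotone_words n) tword. (-1) ^ length ts) =
      (\<Sum>ts\<in>genus_words n \<pi> g (monotone_words n) tword. (-1) ^ (n + card (perm_cycles n \<pi>)) :: rat)"
    by (rule sum.cong[OF refl])
  then show ?thesis by (simp add: num_monotone_eq)
qed

text \<open>The reason for evaluating at -1: a proper word of length k then contributes exactly its
  sign.\<close>

lemma minus_one_gchoose: "(-1 :: rat) gchoose k = (-1) ^ k"
  using gbinomial_minus[of "1 :: rat" k] by (simp flip: binomial_gbinomial)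


theorem theorem2p1:
  fixes n g :: nat and \<alpha> :: "nat list" and \<pi> :: "nat \<Rightarrow> nat"
  assumes "composition n \<alpha>"
    and "\<pi> permutes {1..n}"
    and "cycle_type_of n \<pi> = mset \<alpha>"
  shows "finite {r. num_inequivalent n \<pi> g r \<noteq> 0} \<and>
    finite {r. num_proper n \<pi> g r \<noteq> 0} \<and>
    (\<forall>r. poly (fact_poly n \<pi> g) (of_nat r) = of_nat (num_fact n \<pi> g r)) \<and>
    (-1) ^ (n + length \<alpha>) * of_nat (num_monotone n \<pi> g)
      = Sum_any (\<lambda>r. (-1) ^ r * of_nat (num_inequivalent n \<pi> g r) :: rat) \<and>
    Sum_any (\<lambda>r. (-1) ^ r * of_nat (num_inequivalent n \<pi> g r) :: rat)
      = Sum_any (\<lambda>r. (-1) ^ r * of_nat (num_proper n \<pi> g r)) \<and>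
    Sum_any (\<lambda>r. (-1) ^ r * of_nat (num_proper n \<pi> g r))
      = poly (fact_poly n \<pi> g) (-1)"
proof -
  let ?P = "genus_words n \<pi> g (proper_words n) (\<lambda>w. w)"
  let ?I = "genus_words n \<pi> g (normal_words n) (\<lambda>w. w)"
  let ?M = "genus_words n \<pi> g (monotone_words n) tword"
  have finP: "finite ?P" and finI: "finite ?I"
    using inverse_family_finite_genus_words inverse_family_proper inverse_family_normal_words by blast+
  have "length \<alpha> = size (cycle_type_of n \<pi>)" using assms(3) by simp
  then have l: "length \<alpha> = card (perm_cycles n \<pi>)" by (simp add: cycle_type_of_def)
  have MI: "(\<Sum>ts\<in>?M. (-1) ^ length ts) = (\<Sum>f\<in>?I. (-1) ^ length f :: rat)"
    by (rule inverse_family_sum_genus_words[OF inverse_family_monotone inverse_family_normal_words])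
  have IP: "(\<Sum>f\<in>?I. (-1) ^ length f) = (\<Sum>f\<in>?P. (-1) ^ length f :: rat)"
    by (rule inverse_family_sum_genus_words[OF inverse_family_normal_words inverse_family_proper])
  have I: "Sum_any (\<lambda>r. (-1) ^ r * of_nat (num_inequivalent n \<pi> g r) :: rat) = (\<Sum>f\<in>?I. (-1) ^ length f)"
    unfolding num_inequivalent_eq by (rule Sum_any_by_length[OF finI])
  have P: "Sum_any (\<lambda>r. (-1) ^ r * of_nat (num_proper n \<pi> g r) :: rat) = (\<Sum>f\<in>?P. (-1) ^ length f)"
    unfolding num_proper_eq by (rule Sum_any_by_length[OF finP])
  have "finite {r. num_inequivalent n \<pi> g r \<noteq> 0}"
    unfolding num_inequivalent_eq
    by (rule finite_subset[OF card_by_length_support[OF finI] finite_imageI[OF finI]])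
  moreover have "finite {r. num_proper n \<pi> g r \<noteq> 0}"
    unfolding num_proper_eq
    by (rule finite_subset[OF card_by_length_support[OF finP] finite_imageI[OF finP]])
  moreover have "poly (fact_poly n \<pi> g) (of_nat r) = of_nat (num_fact n \<pi> g r)" for r
    by (simp add: poly_fact_poly num_fact_eq binomial_gbinomial)
  moreover have "poly (fact_poly n \<pi> g) (-1) = (\<Sum>f\<in>?P. (-1) ^ length f)"
    by (simp add: poly_fact_poly minus_one_gchoose)
  ultimately show ?thesis
    unfolding l I P using MI IP sum_sign_monotone[of n \<pi> g] by simp
qed

end
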